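(* Let $V$ be a real vector space of dimension $n$ with a non-degenerate quadratic form $Q$ (of arbitrary signature $(p,q)$, $p+q=n$), let $U\subseteq V$ be an open set, and let $A=\begin{pmatrix} a&b\\c&d\end{pmatrix}\in \mathrm{Mat}(2,\mathrm{Cl}(V))$ be a Vahlen matrix. (Left version.) Let $\mathcal M$ be a left $\mathrm{Cl}(V)$-module and $f:U\to\mathcal M$ a differentiable function. Then $$D\bigl(J_A(x)\,f(Ax)\bigr)=\Omega_A(x)\,J_A(x)\,(Df)(Ax)$$ for all $x\in A^{-1}(U)=\{v\in V:\ Av\in U\}$ such that $cx+d$ is invertible. In particular, if $f$ is left monogenic, so is $x\mapsto J_A(x)f(Ax)$. (Right version.) Let $\mathcal M'$ be a right $\mathrm{Cl}(V)$-module and $g:U\to\mathcal M'$ a differentiable function. Then $$\bigl(g(Ax)\,\widetilde{J_A}(x)\bigr)D=\Omega_A(x)\,(gD)(Ax)\,\widetilde{J_A}(x)$$ for all $x\in A^{-1}(U)$ such that $cx+d$ is invertible. In particular, if $g$ is right monogenic, so is $x\mapsto g(Ax)\widetilde{J_A}(x)$. Here $$J_A(x)=\frac{(cx+d)^{-1}}{|(x\tilde c+\tilde d)(cx+d)|^{n/2-1}},\qquad \widetilde{J_A}(x)=\frac{(x\tilde c+\tilde d)^{-1}}{|(x\tilde c+\tilde d)(cx+d)|^{n/2-1}},\qquad \Omega_A(x)=\frac{\Delta(A)}{(x\tilde c+\tilde d)(cx+d)}.$$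
   Context: $B$ is the symmetric bilinear form with $B(v,v)=Q(v)$. $\mathrm{Cl}(V)$ is the universal Clifford algebra of $(V,Q)$ over $\mathbb R$ with sign convention $v^2=-Q(v)$ for $v\in V\subset \mathrm{Cl}(V)$. The grade involution $\hat{\ }$ is the algebra automorphism with $\hat v=-v$ on $V$; the reversal $\tilde{\ }$ is the algebra anti-automorphism with $\tilde v=v$ on $V$. Vahlen matrices. Let $\mathbb R^{1,1}$ have basis $e_-,e_+$ and let $\hat Q(v+x_-e_-+x_+e_+)=Q(v)-x_-^2+x_+^2$ on $V\oplus\mathbb R^{1,1}$. The map $v+x_-e_-+x_+e_+\mapsto\begin{pmatrix} v& x_--x_+\\ x_-+x_+&-v\end{pmatrix}$ extends to an algebra isomorphism $\mathrm{Cl}(V\oplus\mathbb R^{1,1})\simeq\mathrm{Mat}(2,\mathrm{Cl}(V))$, used to identify the two algebras; under it the grade involution is $\begin{pmatrix} a&b\\c&d\end{pmatrix}\mapsto\begin{pmatrix}\hat a&-\hat b\\-\hat c&\hat d\end{pmatrix}$. A Vahlen matrix is an element of the Lipschitz group of $V\oplus\mathbb R^{1,1}$, i.e. an invertible $A\in\mathrm{Mat}(2,\mathrm{Cl}(V))$ such that $AX\hat A^{-1}\in V\oplus\mathbb R^{1,1}$ for all $X\in V\oplus\mathbb R^{1,1}$. For a Vahlen matrix the pseudo-determinant $\Delta(A)=a\tilde d-b\tilde c$ is a nonzero real number. For $x\in V$ with $cx+d$ invertible in $\mathrm{Cl}(V)$, $Ax:=(ax+b)(cx+d)^{-1}$,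 which lies in $V$, and $(x\tilde c+\tilde d)(cx+d)$ is a nonzero real number. Writing $Av$ presupposes that $cv+d$ is invertible. Dirac operator. Let $e_1,\dots,e_n$ be an orthogonal basis of $V$ with $Q(e_j)=1$ for $j\le p$ and $Q(e_j)=-1$ for $p<j\le p+q=n$, and let $x_1,\dots,x_n$ be the corresponding coordinates. Then $$D=\sum_{j=1}^p e_j\frac{\partial}{\partial x_j}-\sum_{j=p+1}^{p+q}e_j\frac{\partial}{\partial x_j}$$ (independent of the choice of such a basis). It acts on the left on functions with values in a left $\mathrm{Cl}(V)$-module ($Df=\sum_j\pm e_j\,\partial f/\partial x_j$) and on the right on functions with values in a right module ($gD=\sum_j\pm(\partial g/\partial x_j)e_j$). A differentiable function $f$ on an open set is left monogenic if $Df=0$ at all points there, and $g$ is right monogenic if $gD=0$ at all points there. *)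

theory Defs
  imports "HOL-Analysis.Analysis" "HOL-Analysis.Finite_Function_Topology"
begin

section \<open>Quadratic forms\<close>

definition polar_form :: "('v::real_vector \<Rightarrow> real) \<Rightarrow> 'v \<Rightarrow> 'v \<Rightarrow> real" where
  "polar_form Q v w = (Q (v + w) - Q v - Q w) / 2"

definition quadratic_form :: "('v::real_vector \<Rightarrow> real) \<Rightarrow> bool" where
  "quadratic_form Q \<longleftrightarrow> bilinear (polar_form Q) \<and> (\<forall>v. polar_form Q v v = Q v)"

definition nondegenerate :: "('v::real_vector \<Rightarrow> real) \<Rightarrow> bool" where
  "nondegenerate Q \<longleftrightarrow> (\<forall>v. (\<forall>w. polar_form Q v w = 0) \<longrightarrow> v = 0)"

definition orthogonal_basis ::
    "('v::real_vector \<Rightarrow> real) \<Rightarrow> nat \<Rightarrow> nat \<Rightarrow> (nat \<Rightarrow> 'v) \<Rightarrow> bool" where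
  "orthogonal_basis Q p q e \<longleftrightarrow>
     inj_on e {1..p+q} \<and> independent (e ` {1..p+q}) \<and> span (e ` {1..p+q}) = UNIV \<and>
     (\<forall>i\<in>{1..p+q}. \<forall>j\<in>{1..p+q}. i \<noteq> j \<longrightarrow> polar_form Q (e i) (e j) = 0) \<and>
     (\<forall>j\<in>{1..p}. Q (e j) = 1) \<and> (\<forall>j\<in>{p+1..p+q}. Q (e j) = - 1)"


section \<open>The universal Clifford algebra\<close>

text \<open>
  The finitely supported functions on \<^typ>\<open>'v list\<close> form the free real vector space on all
  words over V; with concatenation of words as product it is the free unital algebra on the
  set V. Its quotient by the two-sided ideal generated by the linearity relations of V is the
  tensor algebra T(V), and dividing out \<open>v \<otimes> v + Q v\<close> as well gives the universal Clifford
  algebra. The set below consists of all generators of that ideal, multiplied by arbitrary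
  words u and w from both sides, so that its linear span is the two-sided ideal itself.
\<close>

definition clifford_relators :: "('v::real_vector \<Rightarrow> real) \<Rightarrow> ('v list, real) poly_mapping set" where
  "clifford_relators Q =
     {Poly_Mapping.single (u @ [x + y] @ w) 1 - Poly_Mapping.single (u @ [x] @ w) 1
        - Poly_Mapping.single (u @ [y] @ w) 1 | u w x y. True} \<union>
     {Poly_Mapping.single (u @ [r *\<^sub>R x] @ w) 1 - Poly_Mapping.single (u @ [x] @ w) r
        | u w r x. True} \<union>
     {Poly_Mapping.single (u @ [x, x] @ w) 1 + Poly_Mapping.single (u @ w) (Q x) | u w x. True}"

definition free_extend :: "('v list \<Rightarrow> 'b::real_vector) \<Rightarrow> ('v list, real) poly_mapping \<Rightarrow> 'b" where
  "free_extend T p = (\<Sum>w\<in>Poly_Mapping.keys p. Poly_Mapping.lookup p w *\<^sub>R T w)"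

definition word_eval :: "('v \<Rightarrow> 'b::real_algebra_1) \<Rightarrow> ('v list, real) poly_mapping \<Rightarrow> 'b" where
  "word_eval \<phi> = free_extend (\<lambda>w. prod_list (map \<phi> w))"

text \<open>
  The algebra \<^typ>\<open>'c\<close>, with \<open>\<iota>\<close> as the inclusion of V, is the universal Clifford algebra of
  (V, Q) with sign convention \<open>v\<^sup>2 = - Q v\<close>: it is the quotient of the free algebra by the
  above ideal. The universal mapping property is derived in
  \<open>universal_clifford_mapping_property\<close>.
\<close>

definition universal_clifford ::
    "('v::real_vector \<Rightarrow> real) \<Rightarrow> ('v \<Rightarrow> 'c::real_algebra_1) \<Rightarrow> bool" where
  "universal_clifford Q \<iota> \<longleftrightarrow>
     linear \<iota> \<and> (\<forall>v. \<iota> v * \<iota> v = - of_real (Q v)) \<and>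
     surj (word_eval \<iota>) \<and> (\<forall>p. word_eval \<iota> p = 0 \<longrightarrow> p \<in> span (clifford_relators Q))"

definition algebra_hom :: "('b::real_algebra_1 \<Rightarrow> 'c::real_algebra_1) \<Rightarrow> bool" where
  "algebra_hom h \<longleftrightarrow> linear h \<and> h 1 = 1 \<and> (\<forall>x y. h (x * y) = h x * h y)"

definition algebra_antihom :: "('b::real_algebra_1 \<Rightarrow> 'c::real_algebra_1) \<Rightarrow> bool" where
  "algebra_antihom h \<longleftrightarrow> linear h \<and> h 1 = 1 \<and> (\<forall>x y. h (x * y) = h y * h x)"

definition grade_involution :: "('v \<Rightarrow> 'c::real_algebra_1) \<Rightarrow> 'c \<Rightarrow> 'c" where
  "grade_involution \<iota> = (THE h. algebra_hom h \<and> bij h \<and> (\<forall>v. h (\<iota> v) = - \<iota> v))"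

definition reversal :: "('v \<Rightarrow> 'c::real_algebra_1) \<Rightarrow> 'c \<Rightarrow> 'c" where
  "reversal \<iota> = (THE h. algebra_antihom h \<and> bij h \<and> (\<forall>v. h (\<iota> v) = \<iota> v))"


subsection \<open>Mapping property, existence and uniqueness of the involutions\<close>

lemma free_extend_superset:
  assumes "finite S" "Poly_Mapping.keys p \<subseteq> S"
  shows "free_extend T p = (\<Sum>w\<in>S. Poly_Mapping.lookup p w *\<^sub>R T w)"
  unfolding free_extend_def
  by (rule sum.mono_neutral_left) (use assms in \<open>auto simp: in_keys_iff\<close>)

lemma lookup_scaleR_poly_mapping:
  "Poly_Mapping.lookup (r *\<^sub>R (p :: ('a, real) poly_mapping)) w = r * Poly_Mapping.lookup p w"
proof -
  have "finite {i. r *\<^sub>R Poly_Mapping.lookup p i \<noteq> 0}"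
    by (rule finite_subset[OF _ finite_keys[of p]]) (auto simp: in_keys_iff)
  then show ?thesis
    by (simp add: scaleR_poly_mapping_def Abs_poly_mapping_inverse)
qed

lemma linear_free_extend: "linear (free_extend T)"
proof (rule linearI)
  fix p q :: "('a list, real) poly_mapping" and r :: real
  let ?S = "Poly_Mapping.keys p \<union> Poly_Mapping.keys q"
  have "Poly_Mapping.keys (p + q) \<subseteq> ?S"
    by (rule Poly_Mapping.keys_add)
  then show "free_extend T (p + q) = free_extend T p + free_extend T q"
    by (simp add: free_extend_superset[of ?S] lookup_add scaleR_left_distrib sum.distrib)
  have "Poly_Mapping.keys (r *\<^sub>R p) \<subseteq> Poly_Mapping.keys p"
    by (auto simp: in_keys_iff lookup_scaleR_poly_mapping)
  then show "free_extend T (r *\<^sub>R p) = r *\<^sub>R free_extend T p"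
    by (simp add: free_extend_superset[of "Poly_Mapping.keys p"] lookup_scaleR_poly_mapping
        scaleR_right.sum)
qed

lemma free_extend_single [simp]:
  "free_extend T (Poly_Mapping.single w r) = r *\<^sub>R T w"
  by (simp add: free_extend_def)

lemma free_extend_in_span: "free_extend T p \<in> span (range T)"
  unfolding free_extend_def by (intro span_sum span_scale span_base) auto

lemma universal_clifford_span:
  assumes "universal_clifford Q \<iota>"
  shows "span (range (\<lambda>w. prod_list (map \<iota> w))) = UNIV"
proof -
  have "z \<in> span (range (\<lambda>w. prod_list (map \<iota> w)))" for z
  proof -
    obtain p where "z = word_eval \<iota> p"
      using assms unfolding universal_clifford_def by (meson surjD)
    then show ?thesis
      unfolding word_eval_def using free_extend_in_span by metis
  qed
  then show ?thesis by blast
qed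

lemma universal_clifford_factor:
  fixes T :: "'v::real_vector list \<Rightarrow> 'b::real_vector" and \<iota> :: "'v \<Rightarrow> 'c::real_algebra_1"
  assumes C: "universal_clifford Q \<iota>"
    and T: "\<And>r. r \<in> clifford_relators Q \<Longrightarrow> free_extend T r = 0"
  obtains h :: "'c \<Rightarrow> 'b" where "linear h" "\<And>w. h (prod_list (map \<iota> w)) = T w"
proof -
  have lin: "linear (word_eval \<iota>)"
    unfolding word_eval_def by (rule linear_free_extend)
  have zero: "free_extend T p = 0" if "p \<in> span (clifford_relators Q)" for p
    using linear_eq_0_on_span[OF linear_free_extend T that] by auto
  have eq: "free_extend T p = free_extend T q" if "word_eval \<iota> p = word_eval \<iota> q" for p q
  proof -
    have "word_eval \<iota> (p - q) = 0"
      using that by (simp add: linear_diff[OF lin])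
    then have "free_extend T (p - q) = 0"
      using C zero unfolding universal_clifford_def by blast
    then show ?thesis
      by (simp add: linear_diff[OF linear_free_extend])
  qed
  have ex: "\<exists>p. word_eval \<iota> p = z" for z
    using C unfolding universal_clifford_def by (metis surjD)
  define h where "h z = free_extend T (SOME p. word_eval \<iota> p = z)" for z
  have h: "h (word_eval \<iota> p) = free_extend T p" for p
    unfolding h_def by (rule eq) (rule someI_ex, rule ex)
  show thesis
  proof
    show "linear h"
    proof (rule linearI)
      fix x y :: 'c and r :: real
      obtain p q where pq: "x = word_eval \<iota> p" "y = word_eval \<iota> q"
        using ex by metis
      show "h (x + y) = h x + h y"
        by (metis pq h linear_add[OF lin] linear_add[OF linear_free_extend])
      show "h (r *\<^sub>R x) = r *\<^sub>R h x"
        by (metis pq(1) h linear_scale[OF lin] linear_scale[OF linear_free_extend])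
    qed
  next
    fix w
    show "h (prod_list (map \<iota> w)) = T w"
      using h[of "Poly_Mapping.single w 1"] by (simp add: word_eval_def)
  qed
qed

lemma clifford_generated_mult:
  fixes h :: "'c::real_algebra_1 \<Rightarrow> 'b::real_algebra_1"
  assumes C: "universal_clifford Q \<iota>" and h: "linear h" and op: "bilinear op"
    and words: "\<And>u w. h (prod_list (map \<iota> u) * prod_list (map \<iota> w)) =
      op (h (prod_list (map \<iota> u))) (h (prod_list (map \<iota> w)))"
  shows "h (x * y) = op (h x) (h y)"
proof -
  let ?W = "range (\<lambda>w. prod_list (map \<iota> w))"
  have l1: "linear (\<lambda>x. h (x * y))" "linear (\<lambda>y. h (x * y))" for x y :: 'c
    using h by (auto intro!: linearI simp: linear_add linear_scale distrib_left distrib_right)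
  have l2: "linear (\<lambda>x. op (h x) z)" "linear (\<lambda>x. op z (h x))" for z
    using linear_compose[OF h] op unfolding bilinear_def o_def by blast+
  have W: "z \<in> span ?W" for z
    using universal_clifford_span[OF C] by simp
  have *: "h (prod_list (map \<iota> u) * y) = op (h (prod_list (map \<iota> u))) (h y)" for u y
  proof (rule linear_eq_on_span[OF l1(2) l2(2) _ W])
    fix z assume "z \<in> ?W"
    then obtain w where "z = prod_list (map \<iota> w)" by blast
    then show "h (prod_list (map \<iota> u) * z) = op (h (prod_list (map \<iota> u))) (h z)"
      using words by simp
  qed
  show ?thesis
  proof (rule linear_eq_on_span[OF l1(1) l2(1) _ W])
    fix z assume "z \<in> ?W"
    then obtain w where "z = prod_list (map \<iota> w)" by blast
    then show "h (z * y) = op (h z) (h y)"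
      using * by simp
  qed
qed

lemma relators_words:
  fixes \<phi> :: "'v::real_vector \<Rightarrow> 'b::real_algebra_1"
  assumes "linear \<phi>" "\<And>v. \<phi> v * \<phi> v = - of_real (Q v)" "r \<in> clifford_relators Q"
  shows "free_extend (\<lambda>w. prod_list (map \<phi> w)) r = 0"
    and "free_extend (\<lambda>w. prod_list (rev (map \<phi> w))) r = 0"
proof -
  have sq: "\<phi> v * (\<phi> v * z) = - (Q v *\<^sub>R z)" for v z
    by (metis assms(2) mult.assoc mult_minus_left scaleR_conv_of_real)
  note [simp] = linear_add[OF linear_free_extend] linear_diff[OF linear_free_extend]
    linear_add[OF assms(1)] linear_scale[OF assms(1)] sq
    distrib_left distrib_right mult.assoc
  show "free_extend (\<lambda>w. prod_list (map \<phi> w)) r = 0"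
    using assms(3) unfolding clifford_relators_def
    by (elim UnE CollectE exE conjE; hypsubst) simp_all
  show "free_extend (\<lambda>w. prod_list (rev (map \<phi> w))) r = 0"
    using assms(3) unfolding clifford_relators_def
    by (elim UnE CollectE exE conjE; hypsubst) simp_all
qed

lemma algebra_hom_prod_list: "algebra_hom h \<Longrightarrow> h (prod_list (map f w)) = prod_list (map (h \<circ> f) w)"
  by (induction w) (auto simp: algebra_hom_def)

lemma algebra_antihom_prod_list:
  "algebra_antihom h \<Longrightarrow> h (prod_list (map f w)) = prod_list (rev (map (h \<circ> f) w))"
  by (induction w) (auto simp: algebra_antihom_def)

theorem universal_clifford_mapping_property:
  fixes \<phi> :: "'v::real_vector \<Rightarrow> 'b::real_algebra_1" and \<iota> :: "'v \<Rightarrow> 'c::real_algebra_1"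
  assumes C: "universal_clifford Q \<iota>"
    and \<phi>: "linear \<phi>" "\<And>v. \<phi> v * \<phi> v = - of_real (Q v)"
  shows "\<exists>!h. algebra_hom h \<and> (\<forall>v. h (\<iota> v) = \<phi> v)"
proof (rule ex_ex1I)
  obtain h :: "'c \<Rightarrow> 'b" where h: "linear h" "\<And>w. h (prod_list (map \<iota> w)) = prod_list (map \<phi> w)"
    using universal_clifford_factor[OF C relators_words(1)[OF \<phi>]] by blast
  have "h (x * y) = h x * h y" for x y
  proof (rule clifford_generated_mult[OF C h(1)])
    show "bilinear ((*) :: 'b \<Rightarrow> 'b \<Rightarrow> 'b)"
      by (auto simp: bilinear_def intro!: linearI simp: algebra_simps)
    show "h (prod_list (map \<iota> u) * prod_list (map \<iota> w)) =
      h (prod_list (map \<iota> u)) * h (prod_list (map \<iota> w))" for u w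
      using h(2)[of "u @ w"] by (simp add: h(2))
  qed
  moreover have "h 1 = 1"
    using h(2)[of "[]"] by simp
  moreover have "h (\<iota> v) = \<phi> v" for v
    using h(2)[of "[v]"] by simp
  ultimately show "\<exists>h. algebra_hom h \<and> (\<forall>v. h (\<iota> v) = \<phi> v)"
    using h(1) unfolding algebra_hom_def by blast
next
  fix h k :: "'c \<Rightarrow> 'b"
  assume hk: "algebra_hom h \<and> (\<forall>v. h (\<iota> v) = \<phi> v)" "algebra_hom k \<and> (\<forall>v. k (\<iota> v) = \<phi> v)"
  have comp: "h \<circ> \<iota> = \<phi>" "k \<circ> \<iota> = \<phi>"
    using hk by auto
  have lin: "linear h" "linear k"
    using hk by (auto simp: algebra_hom_def)
  have words: "h x = k x" if x: "x \<in> range (\<lambda>w. prod_list (map \<iota> w))" for x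
  proof -
    obtain w where "x = prod_list (map \<iota> w)"
      using x by blast
    then show ?thesis
      using algebra_hom_prod_list[of h \<iota> w] algebra_hom_prod_list[of k \<iota> w] hk comp by simp
  qed
  show "h = k"
  proof
    fix z
    have "z \<in> span (range (\<lambda>w. prod_list (map \<iota> w)))"
      using universal_clifford_span[OF C] by simp
    then show "h z = k z"
      using linear_eq_on_span[OF lin words] by simp
  qed
qed

lemma universal_clifford_antihom:
  fixes \<phi> :: "'v::real_vector \<Rightarrow> 'b::real_algebra_1" and \<iota> :: "'v \<Rightarrow> 'c::real_algebra_1"
  assumes C: "universal_clifford Q \<iota>"
    and \<phi>: "linear \<phi>" "\<And>v. \<phi> v * \<phi> v = - of_real (Q v)"
  shows "\<exists>!h. algebra_antihom h \<and> (\<forall>v. h (\<iota> v) = \<phi> v)"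
proof (rule ex_ex1I)
  obtain h :: "'c \<Rightarrow> 'b"
    where h: "linear h" "\<And>w. h (prod_list (map \<iota> w)) = prod_list (rev (map \<phi> w))"
    using universal_clifford_factor[OF C relators_words(2)[OF \<phi>]] by blast
  have "h (x * y) = h y * h x" for x y
  proof (rule clifford_generated_mult[OF C h(1), of "\<lambda>a b. b * a"])
    show "bilinear (\<lambda>a b :: 'b. b * a)"
      by (auto simp: bilinear_def intro!: linearI simp: algebra_simps)
    show "h (prod_list (map \<iota> u) * prod_list (map \<iota> w)) =
      h (prod_list (map \<iota> w)) * h (prod_list (map \<iota> u))" for u w
      using h(2)[of "u @ w"] by (simp add: h(2))
  qed
  moreover have "h 1 = 1"
    using h(2)[of "[]"] by simp
  moreover have "h (\<iota> v) = \<phi> v" for v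
    using h(2)[of "[v]"] by simp
  ultimately show "\<exists>h. algebra_antihom h \<and> (\<forall>v. h (\<iota> v) = \<phi> v)"
    using h(1) unfolding algebra_antihom_def by blast
next
  fix h k :: "'c \<Rightarrow> 'b"
  assume hk: "algebra_antihom h \<and> (\<forall>v. h (\<iota> v) = \<phi> v)" "algebra_antihom k \<and> (\<forall>v. k (\<iota> v) = \<phi> v)"
  have comp: "h \<circ> \<iota> = \<phi>" "k \<circ> \<iota> = \<phi>"
    using hk by auto
  have lin: "linear h" "linear k"
    using hk by (auto simp: algebra_antihom_def)
  have words: "h x = k x" if x: "x \<in> range (\<lambda>w. prod_list (map \<iota> w))" for x
  proof -
    obtain w where "x = prod_list (map \<iota> w)"
      using x by blast
    then show ?thesis
      using algebra_antihom_prod_list[of h \<iota> w] algebra_antihom_prod_list[of k \<iota> w] hk comp by simp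
  qed
  show "h = k"
  proof
    fix z
    have "z \<in> span (range (\<lambda>w. prod_list (map \<iota> w)))"
      using universal_clifford_span[OF C] by simp
    then show "h z = k z"
      using linear_eq_on_span[OF lin words] by simp
  qed
qed

lemma algebra_hom_endo_id:
  fixes \<iota> :: "'v::real_vector \<Rightarrow> 'c::real_algebra_1"
  assumes C: "universal_clifford Q \<iota>" and h: "algebra_hom h" "\<And>v. h (\<iota> v) = \<iota> v"
  shows "h z = z"
proof -
  have "algebra_hom (\<lambda>x::'c. x)"
    by (auto simp: algebra_hom_def intro: linearI)
  moreover have "\<exists>!h. algebra_hom h \<and> (\<forall>v. h (\<iota> v) = \<iota> v)"
    by (rule universal_clifford_mapping_property[OF C])
       (use C in \<open>simp_all add: universal_clifford_def\<close>)
  moreover have "algebra_hom h \<and> (\<forall>v. h (\<iota> v) = \<iota> v)"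
    using h by simp
  ultimately have "h = (\<lambda>x. x)"
    by (auto elim!: ex1E)
  then show ?thesis by simp
qed

theorem grade_involution_ex1:
  assumes C: "universal_clifford Q \<iota>"
  shows "\<exists>!h. algebra_hom h \<and> bij h \<and> (\<forall>v. h (\<iota> v) = - \<iota> v)"
proof -
  have lin: "linear \<iota>" and sq: "\<And>v. \<iota> v * \<iota> v = - of_real (Q v)"
    using C by (auto simp: universal_clifford_def)
  have E: "\<exists>!h. algebra_hom h \<and> (\<forall>v. h (\<iota> v) = - \<iota> v)"
    by (rule universal_clifford_mapping_property[OF C])
       (use lin sq in \<open>auto intro: linear_compose_neg\<close>)
  have "bij h" if h: "algebra_hom h" "\<forall>v. h (\<iota> v) = - \<iota> v" for h :: "'b \<Rightarrow> 'b"
  proof -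
    have "algebra_hom (h \<circ> h)"
      using h(1) unfolding algebra_hom_def by (auto intro: linear_compose)
    moreover have "(h \<circ> h) (\<iota> v) = \<iota> v" for v
      using h unfolding algebra_hom_def by (simp add: linear_neg)
    ultimately have "h (h z) = z" for z
      using algebra_hom_endo_id[OF C, of "h \<circ> h"] by simp
    then show ?thesis
      by (intro o_bij[of h h]) auto
  qed
  then show ?thesis using E by metis
qed

theorem reversal_ex1:
  assumes C: "universal_clifford Q \<iota>"
  shows "\<exists>!h. algebra_antihom h \<and> bij h \<and> (\<forall>v. h (\<iota> v) = \<iota> v)"
proof -
  have lin: "linear \<iota>" and sq: "\<And>v. \<iota> v * \<iota> v = - of_real (Q v)"
    using C by (auto simp: universal_clifford_def)
  have E: "\<exists>!h. algebra_antihom h \<and> (\<forall>v. h (\<iota> v) = \<iota> v)"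
    by (rule universal_clifford_antihom[OF C lin sq])
  have "bij h" if h: "algebra_antihom h" "\<forall>v. h (\<iota> v) = \<iota> v" for h :: "'b \<Rightarrow> 'b"
  proof -
    have "algebra_hom (h \<circ> h)"
      using h(1) unfolding algebra_hom_def algebra_antihom_def by (auto intro: linear_compose)
    moreover have "(h \<circ> h) (\<iota> v) = \<iota> v" for v
      using h by simp
    ultimately have "h (h z) = z" for z
      using algebra_hom_endo_id[OF C, of "h \<circ> h"] by simp
    then show ?thesis
      by (intro o_bij[of h h]) auto
  qed
  then show ?thesis using E by metis
qed


section \<open>Inverses and real elements in an algebra\<close>

definition cl_unit :: "'c::ring_1 \<Rightarrow> bool" where
  "cl_unit x \<longleftrightarrow> (\<exists>y. x * y = 1 \<and> y * x = 1)"

definition cl_inv :: "'c::ring_1 \<Rightarrow> 'c" where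
  "cl_inv x = (THE y. x * y = 1 \<and> y * x = 1)"

text \<open>
  \<open>cl_real\<close>, and \<open>mobius\<close> below, are meaningful only where the algebra element in question is
  a real number, respectively a vector. For a Vahlen matrix this holds for its pseudo-determinant
  and at all points where \<open>c x + d\<close> is invertible.
\<close>

definition cl_real :: "'c::real_algebra_1 \<Rightarrow> real" where
  "cl_real z = (THE r. z = of_real r)"


section \<open>Vahlen matrices\<close>

definition mat22 :: "'c::ring_1 \<Rightarrow> 'c \<Rightarrow> 'c \<Rightarrow> 'c \<Rightarrow> 'c^2^2" where
  "mat22 a b c d = vector [vector [a, b], vector [c, d]]"

text \<open>
  The subspace \<open>V \<oplus> \<real>\<^sup>1\<^sup>,\<^sup>1\<close> of Mat(2, Cl(V)), and the grade involution of
  \<open>Cl(V \<oplus> \<real>\<^sup>1\<^sup>,\<^sup>1) = Mat(2, Cl(V))\<close>.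
\<close>

definition vahlen_space :: "('v \<Rightarrow> 'c::real_algebra_1) \<Rightarrow> ('c^2^2) set" where
  "vahlen_space \<iota> =
     {mat22 (\<iota> v) (of_real (s - t)) (of_real (s + t)) (- \<iota> v) | v s t. True}"

definition mat_grade_involution :: "('v \<Rightarrow> 'c::real_algebra_1) \<Rightarrow> 'c^2^2 \<Rightarrow> 'c^2^2" where
  "mat_grade_involution \<iota> A =
     mat22 (grade_involution \<iota> (A$1$1)) (- grade_involution \<iota> (A$1$2))
           (- grade_involution \<iota> (A$2$1)) (grade_involution \<iota> (A$2$2))"

definition vahlen_matrix :: "('v \<Rightarrow> 'c::real_algebra_1) \<Rightarrow> 'c^2^2 \<Rightarrow> bool" where
  "vahlen_matrix \<iota> A \<longleftrightarrow> invertible A \<and>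
     (\<forall>X\<in>vahlen_space \<iota>. A ** X ** matrix_inv (mat_grade_involution \<iota> A) \<in> vahlen_space \<iota>)"

definition pseudo_det :: "('v \<Rightarrow> 'c::real_algebra_1) \<Rightarrow> 'c^2^2 \<Rightarrow> real" where
  "pseudo_det \<iota> A = cl_real (A$1$1 * reversal \<iota> (A$2$2) - A$1$2 * reversal \<iota> (A$2$1))"

definition mobius_denom :: "('v \<Rightarrow> 'c::real_algebra_1) \<Rightarrow> 'c^2^2 \<Rightarrow> 'v \<Rightarrow> 'c" where
  "mobius_denom \<iota> A x = A$2$1 * \<iota> x + A$2$2"

definition mobius_denom_rev :: "('v \<Rightarrow> 'c::real_algebra_1) \<Rightarrow> 'c^2^2 \<Rightarrow> 'v \<Rightarrow> 'c" where
  "mobius_denom_rev \<iota> A x = \<iota> x * reversal \<iota> (A$2$1) + reversal \<iota> (A$2$2)"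

definition mobius :: "('v \<Rightarrow> 'c::real_algebra_1) \<Rightarrow> 'c^2^2 \<Rightarrow> 'v \<Rightarrow> 'v" where
  "mobius \<iota> A x =
     (THE y. \<iota> y = (A$1$1 * \<iota> x + A$1$2) * cl_inv (mobius_denom \<iota> A x))"

definition mobius_preimage :: "('v \<Rightarrow> 'c::real_algebra_1) \<Rightarrow> 'c^2^2 \<Rightarrow> 'v set \<Rightarrow> 'v set" where
  "mobius_preimage \<iota> A U = {x. cl_unit (mobius_denom \<iota> A x) \<and> mobius \<iota> A x \<in> U}"

definition mobius_norm :: "('v \<Rightarrow> 'c::real_algebra_1) \<Rightarrow> 'c^2^2 \<Rightarrow> 'v \<Rightarrow> real" where
  "mobius_norm \<iota> A x = cl_real (mobius_denom_rev \<iota> A x * mobius_denom \<iota> A x)"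

definition J_factor :: "('v::real_vector \<Rightarrow> 'c::real_algebra_1) \<Rightarrow> 'c^2^2 \<Rightarrow> 'v \<Rightarrow> 'c" where
  "J_factor \<iota> A x =
     cl_inv (mobius_denom \<iota> A x) /\<^sub>R
       (\<bar>mobius_norm \<iota> A x\<bar> powr (real (dim (UNIV :: 'v set)) / 2 - 1))"

definition J_factor_rev :: "('v::real_vector \<Rightarrow> 'c::real_algebra_1) \<Rightarrow> 'c^2^2 \<Rightarrow> 'v \<Rightarrow> 'c" where
  "J_factor_rev \<iota> A x =
     cl_inv (mobius_denom_rev \<iota> A x) /\<^sub>R
       (\<bar>mobius_norm \<iota> A x\<bar> powr (real (dim (UNIV :: 'v set)) / 2 - 1))"

definition Omega_factor :: "('v \<Rightarrow> 'c::real_algebra_1) \<Rightarrow> 'c^2^2 \<Rightarrow> 'v \<Rightarrow> real" where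
  "Omega_factor \<iota> A x = pseudo_det \<iota> A / mobius_norm \<iota> A x"


section \<open>Clifford modules and the Dirac operator\<close>

text \<open>
  On V, which is finite-dimensional, the norm serves only to provide the canonical topology.
  Differentiability of module-valued functions refers to a topology on the module; the module
  is a normed space on which every algebra element acts continuously (for a finite-dimensional
  module this is no restriction).
\<close>

definition left_cl_module ::
    "('c::real_algebra_1 \<Rightarrow> 'm::real_normed_vector \<Rightarrow> 'm) \<Rightarrow> bool" where
  "left_cl_module act \<longleftrightarrow>
     (\<forall>x y m. act (x + y) m = act x m + act y m) \<and>
     (\<forall>r x m. act (r *\<^sub>R x) m = r *\<^sub>R act x m) \<and>
     (\<forall>x y m. act (x * y) m = act x (act y m)) \<and>
     (\<forall>m. act 1 m = m) \<and>
     (\<forall>x. bounded_linear (act x))"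

definition right_cl_module ::
    "('m::real_normed_vector \<Rightarrow> 'c::real_algebra_1 \<Rightarrow> 'm) \<Rightarrow> bool" where
  "right_cl_module act \<longleftrightarrow>
     (\<forall>m x y. act m (x + y) = act m x + act m y) \<and>
     (\<forall>m r x. act m (r *\<^sub>R x) = r *\<^sub>R act m x) \<and>
     (\<forall>m x y. act m (x * y) = act (act m x) y) \<and>
     (\<forall>m. act m 1 = m) \<and>
     (\<forall>x. bounded_linear (\<lambda>m. act m x))"

definition partial_deriv ::
    "'v::real_vector \<Rightarrow> ('v \<Rightarrow> 'm::real_normed_vector) \<Rightarrow> 'v \<Rightarrow> 'm" where
  "partial_deriv v f x = vector_derivative (\<lambda>t. f (x + t *\<^sub>R v)) (at 0)"

definition dirac_left ::
    "('v::real_vector \<Rightarrow> 'c) \<Rightarrow> ('c \<Rightarrow> 'm::real_normed_vector \<Rightarrow> 'm) \<Rightarrow>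
     nat \<Rightarrow> nat \<Rightarrow> (nat \<Rightarrow> 'v) \<Rightarrow> ('v \<Rightarrow> 'm) \<Rightarrow> 'v \<Rightarrow> 'm" where
  "dirac_left \<iota> act p q e f x =
     (\<Sum>j=1..p. act (\<iota> (e j)) (partial_deriv (e j) f x)) -
     (\<Sum>j=p+1..p+q. act (\<iota> (e j)) (partial_deriv (e j) f x))"

definition dirac_right ::
    "('v::real_vector \<Rightarrow> 'c) \<Rightarrow> ('m::real_normed_vector \<Rightarrow> 'c \<Rightarrow> 'm) \<Rightarrow>
     nat \<Rightarrow> nat \<Rightarrow> (nat \<Rightarrow> 'v) \<Rightarrow> ('v \<Rightarrow> 'm) \<Rightarrow> 'v \<Rightarrow> 'm" where
  "dirac_right \<iota> act p q e g x =
     (\<Sum>j=1..p. act (partial_deriv (e j) g x) (\<iota> (e j))) -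
     (\<Sum>j=p+1..p+q. act (partial_deriv (e j) g x) (\<iota> (e j)))"

definition left_monogenic ::
    "('v::real_normed_vector \<Rightarrow> 'c) \<Rightarrow> ('c \<Rightarrow> 'm::real_normed_vector \<Rightarrow> 'm) \<Rightarrow>
     nat \<Rightarrow> nat \<Rightarrow> (nat \<Rightarrow> 'v) \<Rightarrow> 'v set \<Rightarrow> ('v \<Rightarrow> 'm) \<Rightarrow> bool" where
  "left_monogenic \<iota> act p q e S f \<longleftrightarrow>
     open S \<and> f differentiable_on S \<and> (\<forall>x\<in>S. dirac_left \<iota> act p q e f x = 0)"

definition right_monogenic ::
    "('v::real_normed_vector \<Rightarrow> 'c) \<Rightarrow> ('m::real_normed_vector \<Rightarrow> 'c \<Rightarrow> 'm) \<Rightarrow>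
     nat \<Rightarrow> nat \<Rightarrow> (nat \<Rightarrow> 'v) \<Rightarrow> 'v set \<Rightarrow> ('v \<Rightarrow> 'm) \<Rightarrow> bool" where
  "right_monogenic \<iota> act p q e S g \<longleftrightarrow>
     open S \<and> g differentiable_on S \<and> (\<forall>x\<in>S. dirac_right \<iota> act p q e g x = 0)"

end

theory Submission
  imports Defs
begin

text \<open>
  Write \<open>~\<close> for the reversal, \<open>u y = c y + d\<close> for the denominator and \<open>r = u(x) u(x)~\<close> for its real norm
  at a regular point \<open>x\<close>. Everything rests on two algebraic facts about a Vahlen matrix. The first
  is that \<open>w = u(x)\<^sup>-\<^sup>1 c\<close> is a vector, so that \<open>u(x + h) = u(x) (1 + w h)\<close>. As
  \<open>(1 + w h) (1 + h w)\<close> is the real number \<open>\<rho> h = 1 - 2 B w h + Q w Q h\<close>, this makes the inverse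
  denominator and the weight explicit near \<open>x\<close>:
  \<open>J(x + h) = (\<rho> h)\<^sup>-\<^sup>n\<^sup>/\<^sup>2 (1 + h w) J(x)\<close>. The second is that conjugation \<open>E h = u h u\<^sup>-\<^sup>1\<close> maps V
  onto V and is an isometry; up to a quadratic error and the factor \<open>\<rho>\<close>, the transformation is
  \<open>x + h \<mapsto> A x + (\<Delta> / r) E h\<close>.

  Differentiating \<open>J(x + h) f(A(x + h))\<close> at \<open>h = 0\<close> therefore gives
  \<open>n (B w h) J f + h w J f + J f'((\<Delta> / r) E h)\<close>. Contracted with the basis, the first term
  contributes \<open>n w J f\<close> and the second \<open>- n w J f\<close>, because \<open>\<Sum>\<^sub>j \<plusminus> e\<^sub>j e\<^sub>j = - n\<close>. In the third,
  \<open>e\<^sub>j u\<^sup>-\<^sup>1 = u\<^sup>-\<^sup>1 E e\<^sub>j\<close> moves J to the left, and what remains is the Dirac operator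
  written in the basis \<open>E e\<^sub>j\<close>, which equals \<open>D\<close> as \<open>E\<close> is an isometry. The factor
  \<open>\<Delta> / r\<close> is \<open>\<Omega>\<close>.

  The two algebraic facts come from the definition of a Vahlen matrix through the twisted centre:
  an element \<open>z\<close> of the Clifford algebra with \<open>z v\<close> equal to \<open>v\<close> times the grade involution of \<open>z\<close>,
  for all vectors \<open>v\<close>, is real (\<open>twisted_central_real\<close>), and the same holds for 2 by 2 matrices
  (\<open>mat_twisted_central_real\<close>). This shows that \<open>A\<close> is homogeneous for the grading (\<open>parity\<close>) and
  has an adjugate with a real product (\<open>adjugate\<close>), and it yields a criterion for being a vector
  (\<open>vector_criterion\<close>). The right version is the left version for the left module in which
  \<open>z\<close> acts as right multiplication by \<open>z~\<close>.
\<close>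

section \<open>Linear and bilinear maps on a finite-dimensional normed space\<close>

text \<open>
  The norm of a linear combination attains a minimum on the coefficient vectors of maximum norm 1,
  and it is positive by linear independence; homogeneity does the rest. The coefficient vectors
  with i-th entry \<open>\<plusminus>1\<close> form a compact set \<open>K i\<close> by the theorem of Tychonoff.
\<close>

lemma coordinates_bounded:
  fixes e :: "'i \<Rightarrow> 'v::real_normed_vector"
  assumes fin: "finite I" and inj: "inj_on e I" and ind: "independent (e ` I)"
  obtains C where "C > 0" "\<And>a i. i \<in> I \<Longrightarrow> \<bar>a i\<bar> \<le> C * norm (\<Sum>j\<in>I. a j *\<^sub>R e j)"
proof -
  define N where "N a = norm (\<Sum>j\<in>I. a j *\<^sub>R e j)" for a :: "'i \<Rightarrow> real"
  define K where "K i = (\<Pi>\<^sub>E j\<in>UNIV. if j = i then {-1, 1} else if j \<in> I then {-1..1} else {0::real})"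
    for i
  have cont: "continuous_on UNIV N"
    unfolding N_def by (intro continuous_intros continuous_on_product_coordinates)
  have cpt: "compact (K i)" for i
  proof -
    have "compactin (product_topology (\<lambda>_. euclidean) UNIV) (K i)"
      unfolding K_def by (auto simp: compactin_PiE)
    then show ?thesis
      by (simp add: euclidean_product_topology)
  qed
  have pos: "N a > 0" if "i \<in> I" "a \<in> K i" for i a
  proof -
    have "a i \<noteq> 0"
      using that by (auto simp: K_def PiE_iff split: if_splits dest: spec[of _ i])
    have "(\<Sum>j\<in>I. a j *\<^sub>R e j) \<noteq> 0"
    proof
      assume "(\<Sum>j\<in>I. a j *\<^sub>R e j) = 0"
      then have "(\<Sum>v\<in>e ` I. a (the_inv_into I e v) *\<^sub>R v) = 0"
        by (simp add: sum.reindex[OF inj] the_inv_into_f_f[OF inj])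
      then have "a (the_inv_into I e (e i)) = 0"
        using independentD[OF ind finite_imageI[OF fin] order_refl,
            of "\<lambda>v. a (the_inv_into I e v)" "e i"] that(1) by simp
      then show False
        using \<open>a i \<noteq> 0\<close> that(1) by (simp add: the_inv_into_f_f[OF inj])
    qed
    then show ?thesis by (simp add: N_def)
  qed
  have "\<exists>m>0. \<forall>a\<in>K i. m \<le> N a" if "i \<in> I" for i
  proof -
    have ne: "K i \<noteq> {}"
      by (auto simp: K_def PiE_eq_empty_iff)
    obtain b where "b \<in> K i" "\<forall>a\<in>K i. N b \<le> N a"
      using continuous_attains_inf[OF cpt ne continuous_on_subset[OF cont]] by auto
    then show ?thesis
      using pos[OF that] by blast
  qed
  then obtain m where m: "\<And>i. i \<in> I \<Longrightarrow> m i > 0" "\<And>i a. i \<in> I \<Longrightarrow> a \<in> K i \<Longrightarrow> m i \<le> N a"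
    by metis
  \<comment> \<open>The sum dominates \<open>1 / m k\<close> for the index \<open>k\<close> of the largest coefficient, whichever it is.\<close>
  define C where "C = 1 + (\<Sum>i\<in>I. 1 / m i)"
  have Cpos: "C > 0"
    unfolding C_def by (intro add_pos_nonneg sum_nonneg) (auto dest: m(1) less_imp_le)
  have "\<bar>a i\<bar> \<le> C * N a" if i: "i \<in> I" for a i
  proof -
    define M where "M = Max ((\<lambda>j. \<bar>a j\<bar>) ` I)"
    have "M \<in> (\<lambda>j. \<bar>a j\<bar>) ` I"
      unfolding M_def by (rule Max_in) (use fin i in auto)
    then obtain k where k: "k \<in> I" "M = \<bar>a k\<bar>" by auto
    have le: "\<bar>a j\<bar> \<le> M" if "j \<in> I" for j
      unfolding M_def by (rule Max_ge) (use fin that in auto)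
    show ?thesis
    proof (cases "M = 0")
      case True
      then show ?thesis
        using le[OF i] Cpos by (simp add: N_def)
    next
      case False
      then have "M > 0" using k by simp
      define b where "b j = (if j \<in> I then a j / M else 0)" for j
      have "b \<in> K k"
        using k le \<open>M > 0\<close>
        by (auto simp: K_def b_def PiE_iff abs_le_iff field_simps) (smt (verit))+
      then have "m k \<le> N b" using m(2) k(1) by blast
      also have "N b = N a / M"
      proof -
        have "(\<Sum>j\<in>I. b j *\<^sub>R e j) = (1 / M) *\<^sub>R (\<Sum>j\<in>I. a j *\<^sub>R e j)"
          by (simp add: b_def scaleR_right.sum)
        then show ?thesis
          using \<open>M > 0\<close> by (simp add: N_def)
      qed
      finally have "M \<le> 1 / m k * N a"
        using m(1)[OF k(1)] \<open>M > 0\<close> by (simp add: field_simps)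
      also have "\<dots> \<le> C * N a"
      proof (rule mult_right_mono)
        have "1 / m k \<le> (\<Sum>i\<in>I. 1 / m i)"
          by (rule member_le_sum) (use k fin m(1) less_imp_le in auto)
        then show "1 / m k \<le> C" by (simp add: C_def)
      qed (simp add: N_def)
      finally show ?thesis using le[OF i] by simp
    qed
  qed
  then show thesis
    using that[OF Cpos] by (simp add: N_def)
qed

lemma finite_dim_linear_bounded:
  fixes e :: "'i \<Rightarrow> 'v::real_normed_vector" and F :: "'v \<Rightarrow> 'w::real_normed_vector"
  assumes fin: "finite I" and inj: "inj_on e I" and ind: "independent (e ` I)"
    and spans: "span (e ` I) = UNIV" and lin: "linear F"
  shows "bounded_linear F"
proof -
  obtain C where C: "C > 0" "\<And>a i. i \<in> I \<Longrightarrow> \<bar>a i\<bar> \<le> C * norm (\<Sum>j\<in>I. a j *\<^sub>R e j)"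
    using coordinates_bounded[OF fin inj ind] by blast
  have "norm (F v) \<le> norm v * (C * (\<Sum>j\<in>I. norm (F (e j))))" for v
  proof -
    have "v \<in> span (e ` I)" using spans by simp
    then obtain c where "v = (\<Sum>x\<in>e ` I. c x *\<^sub>R x)"
      unfolding span_finite[OF finite_imageI[OF fin]] by auto
    then have v: "v = (\<Sum>j\<in>I. c (e j) *\<^sub>R e j)"
      by (simp add: sum.reindex[OF inj])
    have "norm (F v) = norm (\<Sum>j\<in>I. c (e j) *\<^sub>R F (e j))"
      by (subst v) (simp add: linear_sum[OF lin] linear_scale[OF lin])
    also have "\<dots> \<le> (\<Sum>j\<in>I. \<bar>c (e j)\<bar> * norm (F (e j)))"
      by (rule order_trans[OF norm_sum]) simp
    also have "\<dots> \<le> (\<Sum>j\<in>I. (C * norm v) * norm (F (e j)))"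
      using C(2)[of _ "\<lambda>j. c (e j)", folded v] by (intro sum_mono mult_right_mono) auto
    finally show ?thesis by (simp add: sum_distrib_left mult_ac)
  qed
  then show ?thesis
    using lin by (intro bounded_linear_intro) (auto simp: linear_add linear_scale)
qed

text \<open>
  Finite dimension is required of the first argument alone, so that this applies to the action of V
  on a normed module of any dimension.
\<close>

lemma finite_dim_bilinear_bounded:
  fixes e :: "'i \<Rightarrow> 'v::real_normed_vector" and F :: "'v \<Rightarrow> 'w::real_normed_vector \<Rightarrow> 'u::real_normed_vector"
  assumes fin: "finite I" and inj: "inj_on e I" and ind: "independent (e ` I)"
    and spans: "span (e ` I) = UNIV"
    and lin: "\<And>m. linear (\<lambda>v. F v m)" and bnd: "\<And>v. bounded_linear (F v)"
  shows "bounded_bilinear F"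
proof -
  obtain C where C: "C > 0" "\<And>a i. i \<in> I \<Longrightarrow> \<bar>a i\<bar> \<le> C * norm (\<Sum>j\<in>I. a j *\<^sub>R e j)"
    using coordinates_bounded[OF fin inj ind] by blast
  obtain L where L: "\<And>v m. norm (F v m) \<le> norm m * L v"
    using bounded_linear.bounded[OF bnd] by metis
  have bound: "norm (F v m) \<le> norm v * norm m * (C * (\<Sum>j\<in>I. L (e j)))" for v m
  proof -
    have "v \<in> span (e ` I)" using spans by simp
    then obtain c where "v = (\<Sum>x\<in>e ` I. c x *\<^sub>R x)"
      unfolding span_finite[OF finite_imageI[OF fin]] by auto
    then have v: "v = (\<Sum>j\<in>I. c (e j) *\<^sub>R e j)"
      by (simp add: sum.reindex[OF inj])
    have "norm (F v m) = norm (\<Sum>j\<in>I. c (e j) *\<^sub>R F (e j) m)"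
      by (subst v) (simp add: linear_sum[OF lin] linear_scale[OF lin])
    also have "\<dots> \<le> (\<Sum>j\<in>I. \<bar>c (e j)\<bar> * norm (F (e j) m))"
      by (rule order_trans[OF norm_sum]) simp
    also have "\<dots> \<le> (\<Sum>j\<in>I. (C * norm v) * (norm m * L (e j)))"
      using C(2)[of _ "\<lambda>j. c (e j)", folded v] L C(1) by (intro sum_mono mult_mono) auto
    finally show ?thesis by (simp add: sum_distrib_left mult_ac)
  qed
  show ?thesis
  proof
    show "\<exists>K. \<forall>v m. norm (F v m) \<le> norm v * norm m * K"
      using bound by blast
  qed (simp_all add: linear_add[OF lin] linear_scale[OF lin]
        linear_add[OF bounded_linear.linear[OF bnd]] linear_scale[OF bounded_linear.linear[OF bnd]])
qed


section \<open>The Clifford algebra of a space with an orthogonal basis\<close>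

locale clifford_frame =
  fixes Q :: "'v::real_vector \<Rightarrow> real" and \<iota> :: "'v \<Rightarrow> 'c::real_algebra_1"
    and p q :: nat and e :: "nat \<Rightarrow> 'v"
  assumes quadratic: "quadratic_form Q" and nondeg: "nondegenerate Q"
    and universal: "universal_clifford Q \<iota>" and basis: "orthogonal_basis Q p q e"
begin

abbreviation B :: "'v \<Rightarrow> 'v \<Rightarrow> real" where "B \<equiv> polar_form Q"
definition I :: "nat set" where "I = {1..p+q}"
abbreviation gi :: "'c \<Rightarrow> 'c" where "gi \<equiv> grade_involution \<iota>"
abbreviation rv :: "'c \<Rightarrow> 'c" where "rv \<equiv> reversal \<iota>"

lemma bilinear_B: "bilinear B" and B_self [simp]: "B v v = Q v"
  using quadratic by (auto simp: quadratic_form_def)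

lemma linear_B: "linear (B v)" "linear (\<lambda>v. B v w)"
  using bilinear_B by (auto simp: bilinear_def)

lemmas B_simps =
  linear_add[OF linear_B(1)] linear_diff[OF linear_B(1)] linear_neg[OF linear_B(1)]
  linear_scale[OF linear_B(1)] linear_0[OF linear_B(1)] linear_sum[OF linear_B(1)]
  linear_add[OF linear_B(2)] linear_diff[OF linear_B(2)] linear_neg[OF linear_B(2)]
  linear_scale[OF linear_B(2)] linear_0[OF linear_B(2)] linear_sum[OF linear_B(2)]

lemma B_commute: "B v w = B w v"
  by (simp add: polar_form_def add.commute)

lemma Q_scale: "Q (r *\<^sub>R v) = r\<^sup>2 * Q v"
  by (subst (1 2) B_self[symmetric]) (simp add: B_simps power2_eq_square del: B_self)

lemma Q_add: "Q (v + w) = Q v + 2 * B v w + Q w"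
  by (simp add: polar_form_def field_simps)

lemma B_nondeg: "(\<And>w. B v w = 0) \<Longrightarrow> v = 0"
  using nondeg by (auto simp: nondegenerate_def)

lemma linear_iota: "linear \<iota>" and iota_square: "\<iota> v * \<iota> v = - of_real (Q v)"
  using universal by (auto simp: universal_clifford_def)

lemmas iota_simps =
  linear_add[OF linear_iota] linear_diff[OF linear_iota] linear_neg[OF linear_iota]
  linear_scale[OF linear_iota] linear_0[OF linear_iota] linear_sum[OF linear_iota]

lemma iota_anticomm: "\<iota> v * \<iota> w + \<iota> w * \<iota> v = - of_real (2 * B v w)"
proof -
  have "\<iota> (v + w) * \<iota> (v + w) = - of_real (Q v + 2 * B v w + Q w)"
    by (simp add: iota_square Q_add)
  then show ?thesis
    by (simp add: iota_simps iota_square algebra_simps eq_neg_iff_add_eq_0)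
qed

lemma iota_swap: "\<iota> v * \<iota> w = - of_real (2 * B v w) - \<iota> w * \<iota> v"
  using iota_anticomm[of v w] by (simp add: algebra_simps)

lemma inj_iota: "inj \<iota>"
proof (rule injI)
  fix v w assume vw: "\<iota> v = \<iota> w"
  have "B (v - w) x = 0" for x
  proof -
    have "of_real (2 * B (v - w) x) = (0::'c)"
      using iota_anticomm[of "v - w" x] vw by (simp add: iota_simps)
    then show ?thesis
      by (metis mult_eq_0_iff of_real_eq_0_iff zero_neq_numeral)
  qed
  then show "v = w"
    using B_nondeg[of "v - w"] by simp
qed

lemma iota_eq_iff [simp]: "\<iota> v = \<iota> w \<longleftrightarrow> v = w"
  using inj_iota by (auto dest: injD)

lemma finite_I [simp]: "finite I" and card_I [simp]: "card I = p + q"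
  by (simp_all add: I_def)

lemma basis_inj: "inj_on e I" and basis_independent: "independent (e ` I)"
  and basis_span: "span (e ` I) = UNIV"
  and basis_orth: "\<And>i j. i \<in> I \<Longrightarrow> j \<in> I \<Longrightarrow> i \<noteq> j \<Longrightarrow> B (e i) (e j) = 0"
  using basis by (auto simp: orthogonal_basis_def I_def)

lemma basis_Q: "j \<in> I \<Longrightarrow> Q (e j) = (if j \<le> p then 1 else - 1)"
  using basis by (auto simp: orthogonal_basis_def I_def)

lemma basis_Q_square: "j \<in> I \<Longrightarrow> Q (e j) * Q (e j) = 1"
  by (simp add: basis_Q)

lemma dim_V: "dim (UNIV :: 'v set) = p + q"
  using dim_eq_card_independent[OF basis_independent] dim_span[of "e ` I"]
  unfolding basis_span by (simp add: card_image[OF basis_inj])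

lemma basis_expansion: "v = (\<Sum>j\<in>I. (Q (e j) * B v (e j)) *\<^sub>R e j)"
proof -
  have "v \<in> span (e ` I)" using basis_span by simp
  then obtain c where "v = (\<Sum>x\<in>e ` I. c x *\<^sub>R x)"
    unfolding span_finite[OF finite_imageI[OF finite_I]] by auto
  then have v: "v = (\<Sum>j\<in>I. c (e j) *\<^sub>R e j)"
    by (simp add: sum.reindex[OF basis_inj])
  have "B v (e k) = c (e k) * Q (e k)" if k: "k \<in> I" for k
  proof -
    have "B v (e k) = (\<Sum>j\<in>I. c (e j) * B (e j) (e k))"
      by (subst v) (simp add: B_simps)
    also have "\<dots> = (\<Sum>j\<in>I. if j = k then c (e k) * Q (e k) else 0)"
      by (rule sum.cong) (use basis_orth k in auto)
    also have "\<dots> = c (e k) * Q (e k)"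
      using k by simp
    finally show ?thesis .
  qed
  then have "(\<Sum>j\<in>I. (Q (e j) * B v (e j)) *\<^sub>R e j) = (\<Sum>j\<in>I. c (e j) *\<^sub>R e j)"
    by (intro sum.cong) (auto simp: basis_Q)
  then show ?thesis using v by simp
qed

lemma gi_hom: "algebra_hom gi" and gi_iota [simp]: "gi (\<iota> v) = - \<iota> v"
  using theI'[OF grade_involution_ex1[OF universal]] unfolding grade_involution_def by blast+

lemma rv_antihom: "algebra_antihom rv" and rv_iota [simp]: "rv (\<iota> v) = \<iota> v"
  using theI'[OF reversal_ex1[OF universal]] unfolding reversal_def by blast+

lemma linear_gi: "linear gi" and linear_rv: "linear rv"
  using gi_hom rv_antihom by (auto simp: algebra_hom_def algebra_antihom_def)

lemma gi_mult [simp]: "gi (x * y) = gi x * gi y" and gi_1 [simp]: "gi 1 = 1"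
  using gi_hom by (auto simp: algebra_hom_def)

lemma rv_mult [simp]: "rv (x * y) = rv y * rv x" and rv_1 [simp]: "rv 1 = 1"
  using rv_antihom by (auto simp: algebra_antihom_def)

lemmas [simp] =
  linear_add[OF linear_gi] linear_diff[OF linear_gi] linear_neg[OF linear_gi]
  linear_scale[OF linear_gi] linear_0[OF linear_gi]
  linear_add[OF linear_rv] linear_diff[OF linear_rv] linear_neg[OF linear_rv]
  linear_scale[OF linear_rv] linear_0[OF linear_rv]

lemma gi_of_real [simp]: "gi (of_real r) = of_real r"
  and rv_of_real [simp]: "rv (of_real r) = of_real r"
  by (simp_all add: of_real_def)

lemma gi_gi [simp]: "gi (gi z) = z"
proof -
  have "algebra_hom (\<lambda>z. gi (gi z))"
    using linear_compose[OF linear_gi linear_gi] by (simp add: algebra_hom_def o_def)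
  then show ?thesis
    by (rule algebra_hom_endo_id[OF universal]) simp
qed

lemma rv_rv [simp]: "rv (rv z) = z"
proof -
  have "algebra_hom (\<lambda>z. rv (rv z))"
    using linear_compose[OF linear_rv linear_rv] by (simp add: algebra_hom_def o_def)
  then show ?thesis
    by (rule algebra_hom_endo_id[OF universal]) simp
qed

lemma rv_gi: "rv (gi z) = gi (rv z)"
proof -
  have "algebra_hom (\<lambda>z. gi (rv (gi (rv z))))"
    using linear_compose[OF linear_compose[OF linear_rv linear_gi]
        linear_compose[OF linear_rv linear_gi]]
    by (simp add: algebra_hom_def o_def)
  then have "gi (rv (gi (rv (rv z)))) = rv z"
    by (rule algebra_hom_endo_id[OF universal]) simp
  then have "gi (gi (rv (gi z))) = gi (rv z)" by simp
  then show ?thesis by (simp only: gi_gi)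
qed


subsection \<open>The twisted centre\<close>

text \<open>
  The subalgebra generated by the \<open>e\<^sub>i\<close> with \<open>i \<in> S\<close>.
\<close>

definition subalg :: "nat set \<Rightarrow> 'c set" where
  "subalg S = span {prod_list (map (\<lambda>i. \<iota> (e i)) w) | w. set w \<subseteq> S}"

lemma subalg_mult_left:
  assumes "i \<in> S" "z \<in> subalg S" shows "\<iota> (e i) * z \<in> subalg S"
proof -
  let ?W = "{prod_list (map (\<lambda>i. \<iota> (e i)) w) | w. set w \<subseteq> S}"
  have lin: "linear (\<lambda>z. \<iota> (e i) * z)"
    by (auto intro!: linearI simp: distrib_left)
  have "(\<lambda>z. \<iota> (e i) * z) ` ?W \<subseteq> ?W"
  proof clarify
    fix w assume "set w \<subseteq> S"
    then show "\<exists>w'. \<iota> (e i) * prod_list (map (\<lambda>i. \<iota> (e i)) w) = prod_list (map (\<lambda>i. \<iota> (e i)) w') \<and> set w' \<subseteq> S"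
      using assms(1) by (intro exI[of _ "i # w"]) simp
  qed
  then have "span ((\<lambda>z. \<iota> (e i) * z) ` ?W) \<subseteq> span ?W"
    by (rule span_mono)
  then show ?thesis
    using assms(2) unfolding subalg_def linear_span_image[OF lin] by blast
qed

lemma subalg_one: "1 \<in> subalg S"
  unfolding subalg_def by (rule span_base) (auto intro!: exI[of _ "[]"])

lemma subspace_subalg: "subspace (subalg S)"
  by (simp add: subalg_def)

lemma subalg_UNIV: "subalg I = UNIV"
proof -
  have left: "\<iota> v * z \<in> subalg I" if "z \<in> subalg I" for v z
  proof -
    have "\<iota> v * z = (\<Sum>j\<in>I. (Q (e j) * B v (e j)) *\<^sub>R (\<iota> (e j) * z))"
      by (subst basis_expansion[of v]) (simp add: iota_simps sum_distrib_right)
    also have "\<dots> \<in> subalg I"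
      by (intro subspace_sum subspace_scale subspace_subalg subalg_mult_left that)
    finally show ?thesis .
  qed
  have "prod_list (map \<iota> w) \<in> subalg I" for w
    by (induction w) (auto simp: subalg_one left)
  then have "span (range (\<lambda>w. prod_list (map \<iota> w))) \<subseteq> subalg I"
    by (intro span_minimal subspace_subalg) auto
  then show ?thesis
    using universal_clifford_span[OF universal] by auto
qed

text \<open>
  A basis vector that does not occur in a word anticommutes with each letter of the word, and the
  grade involution of the word counts the resulting signs.
\<close>

lemma subalg_twisted_commute:
  assumes "z \<in> subalg S" "j \<in> I" "S \<subseteq> I - {j}"
  shows "z * \<iota> (e j) = \<iota> (e j) * gi z"
proof -
  let ?W = "{prod_list (map (\<lambda>i. \<iota> (e i)) w) | w. set w \<subseteq> S}"
  have words: "prod_list (map (\<lambda>i. \<iota> (e i)) w) * \<iota> (e j) =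
      \<iota> (e j) * gi (prod_list (map (\<lambda>i. \<iota> (e i)) w))" if "set w \<subseteq> S" for w
    using that
  proof (induction w)
    case (Cons i w)
    have "B (e i) (e j) = 0"
      using Cons.prems assms by (intro basis_orth) auto
    then have "\<iota> (e i) * \<iota> (e j) = - (\<iota> (e j) * \<iota> (e i))"
      using iota_swap[of "e i" "e j"] by simp
    then show ?case
      using Cons by (simp add: mult.assoc) (simp add: mult.assoc[symmetric])
  qed simp
  show ?thesis
  proof (rule linear_eq_on_span[where f = "\<lambda>z. z * \<iota> (e j)" and g = "\<lambda>z. \<iota> (e j) * gi z" and B = ?W])
    show "linear (\<lambda>z. z * \<iota> (e j))" "linear (\<lambda>z. \<iota> (e j) * gi z)"
      by (auto intro!: linearI simp: algebra_simps)
  qed (use words assms(1) in \<open>auto simp: subalg_def\<close>)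
qed

text \<open>
  The elements of the form \<open>a + e\<^sub>j b\<close> are stable under left multiplication by every generator:
  \<open>e\<^sub>j\<close> swaps the two summands up to a scalar, and the other generators can be moved past \<open>e\<^sub>j\<close>.
\<close>

lemma subalg_split:
  assumes "z \<in> subalg S" "S \<subseteq> I" "j \<in> S"
  obtains a b where "a \<in> subalg (S - {j})" "b \<in> subalg (S - {j})" "z = a + \<iota> (e j) * b"
proof -
  let ?S = "S - {j}"
  let ?T = "{a + \<iota> (e j) * b | a b. a \<in> subalg ?S \<and> b \<in> subalg ?S}"
  have add: "x + y \<in> ?T" if xy: "x \<in> ?T" "y \<in> ?T" for x y
  proof -
    obtain a b a' b' where "a \<in> subalg ?S" "b \<in> subalg ?S" "x = a + \<iota> (e j) * b"
      "a' \<in> subalg ?S" "b' \<in> subalg ?S" "y = a' + \<iota> (e j) * b'"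
      using xy by blast
    then show ?thesis
      by (intro CollectI exI[of _ "a + a'"] exI[of _ "b + b'"])
        (simp add: algebra_simps subspace_add[OF subspace_subalg])
  qed
  have scale: "r *\<^sub>R x \<in> ?T" if "x \<in> ?T" for r x
  proof -
    obtain a b where "a \<in> subalg ?S" "b \<in> subalg ?S" "x = a + \<iota> (e j) * b"
      using \<open>x \<in> ?T\<close> by blast
    then show ?thesis
      by (intro CollectI exI[of _ "r *\<^sub>R a"] exI[of _ "r *\<^sub>R b"])
        (simp add: algebra_simps subspace_scale[OF subspace_subalg])
  qed
  have base: "x \<in> ?T" if "x \<in> subalg ?S" for x
    using that subspace_0[OF subspace_subalg] by force
  have sub: "subspace ?T"
    unfolding subspace_def using base[OF subspace_0[OF subspace_subalg]] add scale by blast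
  have left: "\<iota> (e i) * x \<in> ?T" if x: "x \<in> ?T" and i: "i \<in> S" for i x
  proof -
    obtain a b where ab: "a \<in> subalg ?S" "b \<in> subalg ?S" "x = a + \<iota> (e j) * b"
      using x by blast
    show ?thesis
    proof (cases "i = j")
      case True
      have "\<iota> (e j) * x = (- Q (e j)) *\<^sub>R b + \<iota> (e j) * a"
        by (simp add: ab(3) distrib_left mult.assoc[symmetric] iota_square scaleR_conv_of_real)
      then show ?thesis
        using True ab subspace_scale[OF subspace_subalg] by blast
    next
      case False
      then have "B (e i) (e j) = 0"
        using assms i by (intro basis_orth) auto
      then have "\<iota> (e i) * (\<iota> (e j) * b) = \<iota> (e j) * (- (\<iota> (e i) * b))"
        using iota_swap[of "e i" "e j"] by (simp add: mult.assoc[symmetric])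
      then have "\<iota> (e i) * x = \<iota> (e i) * a + \<iota> (e j) * (- (\<iota> (e i) * b))"
        by (simp add: ab(3) distrib_left)
      moreover have "\<iota> (e i) * a \<in> subalg ?S" "- (\<iota> (e i) * b) \<in> subalg ?S"
        using False i ab by (auto intro!: subspace_neg[OF subspace_subalg] subalg_mult_left)
      ultimately show ?thesis by blast
    qed
  qed
  have "prod_list (map (\<lambda>i. \<iota> (e i)) w) \<in> ?T" if "set w \<subseteq> S" for w
    using that
  proof (induction w)
    case Nil
    then show ?case using base[OF subalg_one] by simp
  next
    case (Cons i w)
    then show ?case using left by simp
  qed
  then have "subalg S \<subseteq> ?T"
    unfolding subalg_def[of S] by (intro span_minimal sub) auto
  then show thesis
    using assms(1) that by blast
qed

lemma of_real_left_cancel: "r \<noteq> 0 \<Longrightarrow> of_real r * x = 0 \<Longrightarrow> x = (0::'c)"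
  by (simp add: scaleR_conv_of_real[symmetric])

text \<open>
  If \<open>z = a + e\<^sub>j b\<close> with \<open>a\<close> and \<open>b\<close> free of \<open>e\<^sub>j\<close>, then the twisted commutation of \<open>z\<close> with \<open>e\<^sub>j\<close>
  reads \<open>e\<^sub>j e\<^sub>j gi b = - e\<^sub>j e\<^sub>j gi b\<close>, so \<open>b = 0\<close>. Hence the basis vectors can be eliminated from \<open>z\<close>
  one after the other, until only the scalars are left.
\<close>

lemma twisted_central_real:
  assumes tc: "\<And>v. z * \<iota> v = \<iota> v * gi z"
  obtains r where "z = of_real r"
proof -
  have "z \<in> subalg (I - T)" if "finite T" "T \<subseteq> I" for T
    using that
  proof induction
    case empty
    then show ?case by (simp add: subalg_UNIV)
  next
    case (insert j T)
    then have j: "j \<in> I" "j \<in> I - T" and T: "T \<subseteq> I" by auto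
    let ?S = "I - insert j T"
    have S: "I - T - {j} = ?S" "?S \<subseteq> I - {j}" by auto
    obtain a b where ab: "a \<in> subalg ?S" "b \<in> subalg ?S" "z = a + \<iota> (e j) * b"
      using subalg_split[of z "I - T" j] insert.IH[OF T] j S(1) by auto
    note tw = subalg_twisted_commute[OF ab(1) j(1) S(2)] subalg_twisted_commute[OF ab(2) j(1) S(2)]
    have "z * \<iota> (e j) = \<iota> (e j) * gi a + \<iota> (e j) * \<iota> (e j) * gi b"
      by (simp add: ab(3) distrib_right mult.assoc tw)
    moreover have "\<iota> (e j) * gi z = \<iota> (e j) * gi a - \<iota> (e j) * \<iota> (e j) * gi b"
      by (simp add: ab(3) algebra_simps)
    ultimately have "\<iota> (e j) * \<iota> (e j) * gi b = - (\<iota> (e j) * \<iota> (e j) * gi b)"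
      using tc[of "e j"] by (metis add_left_cancel diff_conv_add_uminus)
    then have "of_real (2 * Q (e j)) * gi b = 0"
      by (simp add: iota_square) (metis (no_types) add.right_inverse mult_2 mult.assoc)
    moreover have "2 * Q (e j) \<noteq> 0"
      using basis_Q[OF j(1)] by simp
    ultimately have "gi b = 0"
      using of_real_left_cancel by blast
    then have "b = 0"
      using gi_gi[of b] by simp
    then show ?case using ab by simp
  qed
  from this[of I] have "z \<in> subalg {}" by simp
  also have "subalg {} = span {1}"
    by (simp add: subalg_def)
  finally obtain r where "z = r *\<^sub>R 1"
    by (auto simp: span_singleton)
  then show thesis
    using that by (simp add: of_real_def)
qed

text \<open>
  By non-degeneracy there is a vector \<open>w\<close> with the same anticommutators as \<open>z\<close>. As \<open>z - w\<close> is
  odd, anticommuting with all vectors makes it twisted central, so it is real; being odd as well,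
  it vanishes.
\<close>

lemma vector_criterion:
  assumes odd: "gi z = - z" and anti: "\<And>v. \<exists>r. z * \<iota> v + \<iota> v * z = of_real r"
  obtains w where "z = \<iota> w"
proof -
  obtain c where c: "\<And>v. z * \<iota> v + \<iota> v * z = of_real (c v)"
    using anti by metis
  have cB: "c v = (\<Sum>j\<in>I. Q (e j) * B v (e j) * c (e j))" for v
  proof -
    have "of_real (c v) = (\<Sum>j\<in>I. (Q (e j) * B v (e j)) *\<^sub>R (z * \<iota> (e j) + \<iota> (e j) * z))"
      by (subst c[symmetric], subst (1 2) basis_expansion[of v])
        (simp add: iota_simps sum_distrib_left sum_distrib_right sum.distrib scaleR_add_right)
    also have "\<dots> = of_real (\<Sum>j\<in>I. Q (e j) * B v (e j) * c (e j))"
      by (simp add: c scaleR_conv_of_real)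
    finally show ?thesis
      by (simp only: of_real_eq_iff)
  qed
  define w where "w = (\<Sum>j\<in>I. (- Q (e j) * c (e j) / 2) *\<^sub>R e j)"
  have Bw: "2 * B w v = - c v" for v
    by (subst cB) (simp add: w_def B_simps sum_distrib_left sum_negf[symmetric] B_commute[of v] algebra_simps)
  have "(z - \<iota> w) * \<iota> v = \<iota> v * gi (z - \<iota> w)" for v
  proof -
    have "z * \<iota> v + \<iota> v * z = \<iota> w * \<iota> v + \<iota> v * \<iota> w"
      using c[of v] Bw[of v] iota_anticomm[of w v] by simp
    then show ?thesis
      by (simp add: odd algebra_simps)
  qed
  then obtain r where r: "z - \<iota> w = of_real r"
    using twisted_central_real by blast
  have "gi (z - \<iota> w) = - (z - \<iota> w)"
    by (simp add: odd)
  then have "r = - r"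
    unfolding r by (metis gi_of_real of_real_eq_iff of_real_minus)
  then show thesis
    using r that by simp
qed

end


section \<open>Vahlen matrices\<close>

lemma mat22_nth [simp]:
  "mat22 a b c d $ 1 $ 1 = a" "mat22 a b c d $ 1 $ 2 = b"
  "mat22 a b c d $ 2 $ 1 = c" "mat22 a b c d $ 2 $ 2 = d"
  by (simp_all add: mat22_def)

lemma mat22_eq_iff:
  fixes M N :: "'a^2^2"
  shows "M = N \<longleftrightarrow> M$1$1 = N$1$1 \<and> M$1$2 = N$1$2 \<and> M$2$1 = N$2$1 \<and> M$2$2 = N$2$2"
  by (auto simp: vec_eq_iff forall_2)

lemma mat22_eta: "mat22 (M$1$1) (M$1$2) (M$2$1) (M$2$2) = M"
  by (simp add: mat22_eq_iff)

lemma mat22_mult: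
  "mat22 a b c d ** mat22 a' b' c' d' =
    mat22 (a * a' + b * c') (a * b' + b * d') (c * a' + d * c') (c * b' + d * d')"
  by (simp add: mat22_eq_iff matrix_matrix_mult_def sum_2)

lemma mult_nth_2:
  fixes M N :: "'c::ring_1^2^2"
  shows "(M ** N) $ i $ j = M$i$1 * N$1$j + M$i$2 * N$2$j"
  by (simp add: matrix_matrix_mult_def sum_2)

lemma mat_mult_minus:
  fixes M N :: "'c::ring_1^2^2"
  shows "(- M) ** N = - (M ** N)" "M ** (- N) = - (M ** N)"
  by (simp_all add: mat22_eq_iff mult_nth_2)

lemma mat_eq_mat22: "mat k = mat22 k 0 0 k"
  by (simp add: mat22_eq_iff mat_def)

lemma vahlen_space_eq:
  "vahlen_space \<iota> = {mat22 (\<iota> v) (of_real l) (of_real m) (- \<iota> v) | v l m. True}"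
proof -
  have "\<exists>s t. mat22 (\<iota> v) (of_real l) (of_real m) (- \<iota> v) =
      mat22 (\<iota> v) (of_real (s - t)) (of_real (s + t)) (- \<iota> v)" for v l m
    by (intro exI[of _ "(l + m) / 2"] exI[of _ "(m - l) / 2"]) (simp add: field_simps)
  then show ?thesis
    unfolding vahlen_space_def by blast
qed

lemma matrix_inverse:
  assumes "invertible (M :: 'c::semiring_1^'n^'n)"
  shows "M ** matrix_inv M = mat 1" "matrix_inv M ** M = mat 1"
  using someI_ex[OF assms[unfolded invertible_def]] by (auto simp: matrix_inv_def)

context clifford_frame
begin

abbreviation mgi :: "'c^2^2 \<Rightarrow> 'c^2^2" where "mgi \<equiv> mat_grade_involution \<iota>"

text \<open>
  The reversal of \<open>Cl(V \<oplus> \<real>\<^sup>1\<^sup>,\<^sup>1)\<close> in matrix form: the anti-automorphism that fixes \<open>V \<oplus> \<real>\<^sup>1\<^sup>,\<^sup>1\<close>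
  pointwise.
\<close>

definition mat_rev :: "'c^2^2 \<Rightarrow> 'c^2^2" where
  "mat_rev M = mat22 (rv (gi (M$2$2))) (rv (gi (M$1$2))) (rv (gi (M$2$1))) (rv (gi (M$1$1)))"

lemma mgi_mult: "mgi (M ** N) = mgi M ** mgi N"
  by (simp add: mat_grade_involution_def mat22_mult mult_nth_2)

lemma mgi_mgi [simp]: "mgi (mgi M) = M"
  by (simp add: mat_grade_involution_def mat22_eta)

lemma mgi_one: "mgi (mat 1) = mat 1"
  by (simp add: mat_grade_involution_def mat_eq_mat22)

lemma mat_rev_mult: "mat_rev (M ** N) = mat_rev N ** mat_rev M"
  by (simp add: mat_rev_def mat22_mult mult_nth_2 add.commute)

lemma mgi_mat_rev: "mgi (mat_rev M) = mat_rev (mgi M)"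
  by (simp add: mat_rev_def mat_grade_involution_def rv_gi)

lemma mgi_vahlen_space: "X \<in> vahlen_space \<iota> \<Longrightarrow> mgi X = - X"
  by (auto simp: vahlen_space_eq mat_grade_involution_def mat22_eq_iff)

lemma mat_rev_vahlen_space: "X \<in> vahlen_space \<iota> \<Longrightarrow> mat_rev X = X"
  by (auto simp: vahlen_space_eq mat_rev_def mat22_eq_iff)

text \<open>
  Twisted commutation with \<open>e\<^sub>-\<close> and \<open>e\<^sub>+\<close> makes \<open>Z\<close> diagonal, with entries exchanged by the
  grade involution, and twisted commutation with \<open>V\<close> makes these entries twisted central.
\<close>

lemma mat_twisted_central_real:
  assumes tc: "\<And>X. X \<in> vahlen_space \<iota> \<Longrightarrow> Z ** X = X ** mgi Z"
  obtains r where "Z = mat (of_real r)"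
proof -
  have X: "Z ** mat22 (\<iota> v) (of_real l) (of_real m) (- \<iota> v) =
      mat22 (\<iota> v) (of_real l) (of_real m) (- \<iota> v) ** mgi Z" for v l m
    by (rule tc) (auto simp: vahlen_space_eq)
  note eqs = X[unfolded mat22_eq_iff mult_nth_2 mat_grade_involution_def mat22_nth]
  have 1: "Z$1$2 = - gi (Z$2$1)" "Z$1$1 = gi (Z$2$2)"
    using eqs[of 0 1 1, THEN conjunct1] eqs[of 0 1 1, THEN conjunct2, THEN conjunct1] by (simp_all add: iota_simps)
  have 2: "Z$1$2 = gi (Z$2$1)"
    using eqs[of 0 "-1" 1, THEN conjunct1] by (simp add: iota_simps)
  have 3: "Z$1$2 = 0"
  proof -
    have "2 *\<^sub>R Z$1$2 = 0"
      by (metis 1(1) 2 scaleR_2 add.right_inverse)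
    then show ?thesis by simp
  qed
  then have 4: "Z$2$1 = 0"
    using 2 gi_gi[of "Z$2$1"] by simp
  have "Z$1$1 * \<iota> v = \<iota> v * gi (Z$1$1)" for v
    using eqs[of v 0 0, THEN conjunct1] by simp
  then obtain r where r: "Z$1$1 = of_real r"
    using twisted_central_real by blast
  then have "Z$2$2 = of_real r"
    using 1(2) gi_gi[of "Z$2$2"] by simp
  then show thesis
    using 3 4 r that[of r] by (simp add: mat_eq_mat22 mat22_eq_iff)
qed

end

locale vahlen = clifford_frame +
  fixes A :: "'b^2^2" and a b c d :: 'b
  assumes vahlen: "vahlen_matrix \<iota> A" and A_eq: "A = mat22 a b c d"
begin

lemma mat_of_real_commute: "mat (of_real r) ** M = M ** mat (of_real r)" for M :: "'b^2^2"
  by (simp add: mat22_eq_iff mat_eq_mat22 mult_nth_2 of_real_def)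

lemma mat_of_real_mult: "mat (of_real r) ** mat (of_real s) = (mat (of_real (r * s)) :: 'b^2^2)"
  by (simp add: mat_eq_mat22 mat22_mult)

definition A_inv :: "'b^2^2" where "A_inv = matrix_inv A"

lemma A_inverse: "A ** A_inv = mat 1" "A_inv ** A = mat 1"
  using vahlen matrix_inverse by (auto simp: vahlen_matrix_def A_inv_def)

lemma mgi_A_inverse: "mgi A ** mgi A_inv = mat 1" "mgi A_inv ** mgi A = mat 1"
  by (metis A_inverse mgi_mult mgi_one)+

text \<open>
  The second equation is the image of the first under the grade involution, which is \<open>-1\<close> on
  \<open>V \<oplus> \<real>\<^sup>1\<^sup>,\<^sup>1\<close>.
\<close>

lemma sandwich_inv:
  assumes X: "X \<in> vahlen_space \<iota>"
  obtains Y where "Y \<in> vahlen_space \<iota>" "A ** X = Y ** mgi A" "mgi A ** X = Y ** A"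
proof -
  let ?Y = "A ** X ** matrix_inv (mgi A)"
  have "invertible (mgi A)"
    using mgi_A_inverse by (auto simp: invertible_def)
  then have *: "A ** X = ?Y ** mgi A"
    by (simp add: matrix_mul_assoc[symmetric] matrix_inverse)
  have Y: "?Y \<in> vahlen_space \<iota>"
    using vahlen X by (auto simp: vahlen_matrix_def)
  have "mgi A ** mgi X = mgi ?Y ** A"
    using arg_cong[OF *, of mgi] by (simp add: mgi_mult)
  then have "mgi A ** X = ?Y ** A"
    unfolding mgi_vahlen_space[OF X] mgi_vahlen_space[OF Y]
    by (simp add: mat_mult_minus)
  then show thesis
    using that Y * by blast
qed

text \<open>
  Comparing the two equations of \<open>sandwich_inv\<close> shows that the quotient of \<open>A\<close> by its grade
  involution is twisted central, hence a real number \<open>t\<close>; applying the involution twice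
  gives \<open>t\<^sup>2 = 1\<close>.
\<close>

lemma parity: obtains t where "t * t = 1" "mgi A = A ** mat (of_real t)"
proof -
  let ?T = "mgi A_inv ** A"
  have "?T ** X = X ** mgi ?T" if X: "X \<in> vahlen_space \<iota>" for X
  proof -
    obtain Y where Y: "A ** X = Y ** mgi A" "mgi A ** X = Y ** A"
      using sandwich_inv[OF X] by blast
    have "?T ** X = mgi A_inv ** (Y ** A) ** A_inv ** mgi A"
      by (simp add: Y(1) matrix_mul_assoc[symmetric]) (simp add: matrix_mul_assoc A_inverse)
    also have "\<dots> = X ** mgi ?T"
      unfolding Y(2)[symmetric] by (simp add: mgi_mult matrix_mul_assoc mgi_A_inverse)
    finally show ?thesis .
  qed
  then obtain t where t: "?T = mat (of_real t)"
    using mat_twisted_central_real by blast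
  have "mgi A ** ?T = A"
    by (simp add: matrix_mul_assoc mgi_A_inverse)
  then have A: "A = mgi A ** mat (of_real t)"
    by (simp add: t)
  have "mgi A = A ** mgi (mat (of_real t))"
    by (subst A) (simp add: mgi_mult)
  also have "mgi (mat (of_real t)) = mat (of_real t)"
    by (simp add: mat_eq_mat22 mat_grade_involution_def)
  finally have gA: "mgi A = A ** mat (of_real t)" .
  have "A = A ** mat (of_real (t * t))"
    using A by (simp add: gA mat_of_real_mult matrix_mul_assoc[symmetric])
  then have "A_inv ** A = A_inv ** A ** mat (of_real (t * t))"
    by (simp add: matrix_mul_assoc[symmetric])
  then have "mat 1 = (mat (of_real (t * t)) :: 'b^2^2)"
    by (simp add: A_inverse)
  then have "of_real (t * t) = (1::'b)"
    by (simp add: mat_eq_mat22 mat22_eq_iff)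
  then have "t * t = 1"
    by (metis of_real_1 of_real_eq_iff)
  then show thesis using that gA by blast
qed

text \<open>
  The reversal of the grade involution of \<open>A\<close>, which replaces the adjugate matrix over a
  commutative ring.
\<close>

definition A_adj :: "'b^2^2" where
  "A_adj = mat22 (rv d) (- rv b) (- rv c) (rv a)"

lemma A_adj_eq: "A_adj = mat_rev (mgi A)"
  by (simp add: A_adj_def mat_rev_def A_eq mat_grade_involution_def)

text \<open>
  Applying the reversal to \<open>A X = Y (mgi A)\<close> and comparing with the original equation shows that
  \<open>A_adj A\<close> is twisted central. The number \<open>\<delta>\<close> is the pseudo-determinant.
\<close>

lemma adjugate:
  obtains \<delta> where "\<delta> \<noteq> 0" "A_adj ** A = mat (of_real \<delta>)" "A ** A_adj = mat (of_real \<delta>)"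
proof -
  have "A_adj ** A ** X = X ** mgi (A_adj ** A)" if X: "X \<in> vahlen_space \<iota>" for X
  proof -
    obtain Y where Y: "Y \<in> vahlen_space \<iota>" "A ** X = Y ** mgi A"
      using sandwich_inv[OF X] by blast
    have "A_adj ** A ** X = A_adj ** Y ** mgi A"
      by (simp add: matrix_mul_assoc[symmetric] Y(2))
    also have "A_adj ** Y = X ** mat_rev A"
      using arg_cong[OF Y(2), of mat_rev] mat_rev_vahlen_space X Y(1)
      by (simp add: mat_rev_mult A_adj_eq)
    finally show ?thesis
      by (simp add: mgi_mult A_adj_eq mgi_mat_rev matrix_mul_assoc)
  qed
  then obtain \<delta> where \<delta>: "A_adj ** A = mat (of_real \<delta>)"
    using mat_twisted_central_real by blast
  have *: "A_adj = mat (of_real \<delta>) ** A_inv"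
    unfolding \<delta>[symmetric] by (simp add: matrix_mul_assoc[symmetric] A_inverse)
  have "A ** A_adj = mat (of_real \<delta>)"
    by (simp add: * matrix_mul_assoc mat_of_real_commute[symmetric])
      (simp add: matrix_mul_assoc[symmetric] A_inverse)
  moreover have "\<delta> \<noteq> 0"
  proof
    assume "\<delta> = 0"
    then have "A_adj = 0"
      by (simp add: * mat22_eq_iff mult_nth_2 mat_eq_mat22)
    then have "rv a = 0" "rv b = 0" "rv c = 0" "rv d = 0"
      by (simp_all add: A_adj_def mat22_eq_iff)
    then have "a = 0" "b = 0" "c = 0" "d = 0"
      by (metis rv_rv linear_0[OF linear_rv])+
    then show False
      using A_inverse(1) by (simp add: A_eq mat22_eq_iff mult_nth_2 mat_eq_mat22)
  qed
  ultimately show thesis using that \<delta> by blast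
qed

text \<open>
  Up to a real factor, \<open>A_adj\<close> is the inverse of the grade involution of \<open>A\<close>, by
  \<open>parity\<close> and \<open>adjugate\<close>. In this form the defining property involves no inverse, so that it can
  be read off entry by entry.
\<close>

lemma sandwich_adj:
  assumes X: "X \<in> vahlen_space \<iota>" shows "A ** X ** A_adj \<in> vahlen_space \<iota>"
proof -
  obtain t where t: "t * t = 1" "mgi A = A ** mat (of_real t)"
    using parity by blast
  obtain \<delta> where \<delta>: "A ** A_adj = mat (of_real \<delta>)"
    using adjugate by blast
  obtain Y where Y: "Y \<in> vahlen_space \<iota>" "A ** X = Y ** mgi A"
    using sandwich_inv[OF X] by blast
  have "A ** X ** A_adj = Y ** (mat (of_real t) ** (A ** A_adj))"
    unfolding Y(2) t(2) mat_of_real_commute[of t A, symmetric] by (simp add: matrix_mul_assoc)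
  also have "\<dots> = Y ** mat (of_real (t * \<delta>))"
    by (simp add: \<delta> mat_of_real_mult)
  finally have eq: "A ** X ** A_adj = Y ** mat (of_real (t * \<delta>))" .
  obtain y l m where "Y = mat22 (\<iota> y) (of_real l) (of_real m) (- \<iota> y)"
    using Y(1) by (auto simp: vahlen_space_eq)
  then have "A ** X ** A_adj = mat22 (\<iota> ((t * \<delta>) *\<^sub>R y)) (of_real (t * \<delta> * l)) (of_real (t * \<delta> * m))
      (- \<iota> ((t * \<delta>) *\<^sub>R y))"
    by (simp add: eq mat_eq_mat22 mat22_mult iota_simps of_real_def mult.commute)
  then show ?thesis
    unfolding vahlen_space_eq by blast
qed

lemma sandwich_entries:
  obtains y r where
    "(a * \<iota> v + of_real m * b) * rv d - (of_real l * a - b * \<iota> v) * rv c = \<iota> y"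
    "(c * \<iota> v + of_real m * d) * rv d - (of_real l * c - d * \<iota> v) * rv c = of_real r"
proof -
  have "A ** mat22 (\<iota> v) (of_real l) (of_real m) (- \<iota> v) ** A_adj \<in> vahlen_space \<iota>"
    by (rule sandwich_adj) (auto simp: vahlen_space_eq)
  then show thesis
    unfolding A_eq A_adj_def mat22_mult vahlen_space_eq
    by (elim CollectE exE conjE) (rule that; simp add: mat22_eq_iff of_real_def algebra_simps)
qed

end


section \<open>Moebius transformations near a regular point\<close>

lemma cl_inv_eqI: "x * y = 1 \<Longrightarrow> y * x = 1 \<Longrightarrow> cl_inv x = y"
  unfolding cl_inv_def by (rule the_equality) (auto, metis mult.assoc mult_1_left mult_1_right)

lemma cl_real_of_real [simp]: "cl_real (of_real r :: 'c::real_algebra_1) = r"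
  unfolding cl_real_def by (rule the_equality) auto

context vahlen
begin

definition \<delta> :: real where "\<delta> = pseudo_det \<iota> A"
definition den :: "'a \<Rightarrow> 'b" where "den x = c * \<iota> x + d"
definition num :: "'a \<Rightarrow> 'b" where "num x = a * \<iota> x + b"

lemma mobius_denom_eq: "mobius_denom \<iota> A x = den x" "mobius_denom_rev \<iota> A x = rv (den x)"
  by (simp_all add: mobius_denom_def mobius_denom_rev_def A_eq den_def)

lemma delta_nonzero: "\<delta> \<noteq> 0"
  and adj_relations:
    "rv d * a - rv b * c = of_real \<delta>" "rv d * b = rv b * d"
    "rv c * a = rv a * c" "rv a * d - rv c * b = of_real \<delta>" "c * rv d = d * rv c"
proof -
  obtain r where r: "r \<noteq> 0" "A_adj ** A = mat (of_real r)" "A ** A_adj = mat (of_real r)"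
    using adjugate by blast
  note eqs = r(2,3)[unfolded A_adj_def A_eq mat22_mult mat_eq_mat22 mat22_eq_iff mat22_nth]
  have "\<delta> = r"
    unfolding \<delta>_def pseudo_det_def using eqs(2) by (simp add: A_eq)
  then show "\<delta> \<noteq> 0" "rv d * a - rv b * c = of_real \<delta>" "rv d * b = rv b * d"
    "rv c * a = rv a * c" "rv a * d - rv c * b = of_real \<delta>" "c * rv d = d * rv c"
    using r(1) eqs by (auto simp: algebra_simps)
qed

text \<open>
  The source of all difference formulas: multiplied out, the coefficients are the entries of
  \<open>A_adj A\<close>. Divided by the denominators from both sides, it says
  \<open>A y - A x = \<delta> (u(x)~)\<^sup>-\<^sup>1 (y - x) u(y)\<^sup>-\<^sup>1\<close>, where \<open>u\<close> is \<open>den\<close> and \<open>~\<close> is \<open>rv\<close>.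
\<close>

lemma cross_difference:
  "rv (den x) * num y - rv (num x) * den y = of_real \<delta> * \<iota> (y - x)"
proof -
  have "rv (den x) * num y - rv (num x) * den y =
      \<iota> x * (rv c * a - rv a * c) * \<iota> y - \<iota> x * (rv a * d - rv c * b)
      + (rv d * a - rv b * c) * \<iota> y + (rv d * b - rv b * d)"
    by (simp add: den_def num_def algebra_simps)
  then show ?thesis
    by (simp only: adj_relations) (simp add: iota_simps of_real_def algebra_simps)
qed

text \<open>
  The first column of \<open>sandwich_adj\<close> for the matrix with entries \<open>h\<close>, \<open>2 B x h\<close>, \<open>0\<close> and \<open>-h\<close>. It is the
  derivative in direction \<open>h\<close> of the matrix used in \<open>sandwich_values\<close>, and the left hand sides are
  the corresponding derivatives of numerator and denominator times the reversed denominator.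
\<close>

lemma tangent:
  obtains z l where
    "a * \<iota> h * rv (den x) + num x * \<iota> h * rv c = \<iota> z"
    "c * \<iota> h * rv (den x) + den x * \<iota> h * rv c = of_real l"
proof -
  have anti: "k * \<iota> h * \<iota> x * rv c + k * \<iota> x * \<iota> h * rv c = - (of_real (2 * B x h) * k * rv c)" for k
  proof -
    have "k * \<iota> h * \<iota> x * rv c + k * \<iota> x * \<iota> h * rv c = k * (\<iota> x * \<iota> h + \<iota> h * \<iota> x) * rv c"
      by (simp add: algebra_simps)
    then show ?thesis
      by (simp only: iota_anticomm) (simp add: of_real_def)
  qed
  obtain y r where yr:
    "(a * \<iota> h + of_real 0 * b) * rv d - (of_real (2 * B x h) * a - b * \<iota> h) * rv c = \<iota> y"
    "(c * \<iota> h + of_real 0 * d) * rv d - (of_real (2 * B x h) * c - d * \<iota> h) * rv c = of_real r"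
    using sandwich_entries by blast
  show thesis
  proof (rule that)
    have "a * \<iota> h * rv (den x) + num x * \<iota> h * rv c =
        (a * \<iota> h * \<iota> x * rv c + a * \<iota> x * \<iota> h * rv c) + (a * \<iota> h * rv d + b * \<iota> h * rv c)"
      by (simp add: den_def num_def algebra_simps)
    also have "\<dots> = \<iota> y"
      unfolding anti yr(1)[symmetric] by (simp add: algebra_simps)
    finally show "a * \<iota> h * rv (den x) + num x * \<iota> h * rv c = \<iota> y" .
    have "c * \<iota> h * rv (den x) + den x * \<iota> h * rv c =
        (c * \<iota> h * \<iota> x * rv c + c * \<iota> x * \<iota> h * rv c) + (c * \<iota> h * rv d + d * \<iota> h * rv c)"
      by (simp add: den_def algebra_simps)
    also have "\<dots> = of_real r"
      unfolding anti yr(2)[symmetric] by (simp add: algebra_simps)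
    finally show "c * \<iota> h * rv (den x) + den x * \<iota> h * rv c = of_real r" .
  qed
qed

text \<open>
  The first column of \<open>sandwich_adj\<close> for the matrix with entries \<open>x\<close>, \<open>Q x\<close>, \<open>1\<close> and \<open>-x\<close>. It is the
  null vector that represents the point \<open>x\<close> in \<open>V \<oplus> \<real>\<^sup>1\<^sup>,\<^sup>1\<close>, and it factors as the column \<open>(x, 1)\<close> times
  the row \<open>(1, -x)\<close>.
\<close>

lemma sandwich_values:
  obtains z r where "num x * rv (den x) = \<iota> z" "den x * rv (den x) = of_real r"
proof -
  have sq: "k * \<iota> x * \<iota> x * rv c = - (of_real (Q x) * k * rv c)" for k
    by (simp only: mult.assoc[of k] iota_square) (simp add: of_real_def)
  obtain y r where yr:
    "(a * \<iota> x + of_real 1 * b) * rv d - (of_real (Q x) * a - b * \<iota> x) * rv c = \<iota> y"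
    "(c * \<iota> x + of_real 1 * d) * rv d - (of_real (Q x) * c - d * \<iota> x) * rv c = of_real r"
    using sandwich_entries by blast
  show thesis
  proof (rule that)
    have "num x * rv (den x) = a * \<iota> x * \<iota> x * rv c + ((a * \<iota> x + b) * rv d + b * \<iota> x * rv c)"
      by (simp add: den_def num_def algebra_simps)
    also have "\<dots> = \<iota> y"
      unfolding sq yr(1)[symmetric] by (simp add: algebra_simps)
    finally show "num x * rv (den x) = \<iota> y" .
    have "den x * rv (den x) = c * \<iota> x * \<iota> x * rv c + ((c * \<iota> x + d) * rv d + d * \<iota> x * rv c)"
      by (simp add: den_def algebra_simps)
    also have "\<dots> = of_real r"
      unfolding sq yr(2)[symmetric] by (simp add: algebra_simps)
    finally show "den x * rv (den x) = of_real r" .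
  qed
qed

lemma den_homogeneous:
  obtains t where "t * t = 1" "\<And>x. gi (den x) = t *\<^sub>R den x" "gi c = - (t *\<^sub>R c)"
proof -
  obtain t where t: "t * t = 1" "mgi A = A ** mat (of_real t)"
    using parity by blast
  have "- gi c = t *\<^sub>R c" "gi d = t *\<^sub>R d"
    using t(2) by (simp_all add: A_eq mat_eq_mat22 mat22_mult mat_grade_involution_def
        mat22_eq_iff of_real_def)
  then have "gi c = - (t *\<^sub>R c)" "gi d = t *\<^sub>R d"
    by (simp_all add: minus_equation_iff[of "gi c"])
  then show thesis
    using that t(1) by (simp add: den_def algebra_simps)
qed

text \<open>
  The reversed denominator divided by the norm is a two-sided inverse of the denominator; this
  evaluates the implicitly defined \<open>cl_inv\<close> and \<open>mobius_norm\<close>.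
\<close>

lemma regularI:
  assumes "den x * rv (den x) = of_real r" "rv (den x) * den x = of_real r" "r \<noteq> 0"
  shows "cl_unit (den x)" "cl_inv (den x) = rv (den x) /\<^sub>R r"
    "cl_inv (rv (den x)) = den x /\<^sub>R r" "mobius_norm \<iota> A x = r"
proof -
  have *: "den x * (rv (den x) /\<^sub>R r) = 1" "(rv (den x) /\<^sub>R r) * den x = 1"
    using assms by (simp_all add: of_real_def)
  then show "cl_unit (den x)" unfolding cl_unit_def by blast
  show "cl_inv (den x) = rv (den x) /\<^sub>R r" using * by (rule cl_inv_eqI)
  show "cl_inv (rv (den x)) = den x /\<^sub>R r" using * by (intro cl_inv_eqI) simp_all
  show "mobius_norm \<iota> A x = r" using assms(2) by (simp add: mobius_norm_def mobius_denom_eq)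
qed

text \<open>
  The norm is real by \<open>sandwich_values\<close>, and invertibility of the denominator makes it non-zero and
  allows the two factors to be interchanged.
\<close>

lemma regularD:
  assumes "cl_unit (den x)"
  shows "mobius_norm \<iota> A x \<noteq> 0" "den x * rv (den x) = of_real (mobius_norm \<iota> A x)"
    "rv (den x) * den x = of_real (mobius_norm \<iota> A x)"
proof -
  obtain i where i: "den x * i = 1" "i * den x = 1"
    using assms unfolding cl_unit_def by blast
  obtain r where r: "den x * rv (den x) = of_real r"
    using sandwich_values by blast
  have 1: "rv (den x) = i * of_real r"
    by (metis i(2) r mult.assoc mult_1_left)
  then have 2: "rv (den x) * den x = of_real r"
    using i(2) by (simp add: of_real_def)
  have "r \<noteq> 0"
  proof
    assume "r = 0"
    then have "rv (rv (den x)) = 0"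
      using 1 by simp
    then show False using i(1) by simp
  qed
  moreover have "mobius_norm \<iota> A x = r"
    using regularI[OF r 2 \<open>r \<noteq> 0\<close>] by simp
  ultimately show "mobius_norm \<iota> A x \<noteq> 0" "den x * rv (den x) = of_real (mobius_norm \<iota> A x)"
    "rv (den x) * den x = of_real (mobius_norm \<iota> A x)"
    using r 2 by simp_all
qed

lemma mobius_eqI:
  assumes "\<iota> z = num x * cl_inv (den x)" shows "mobius \<iota> A x = z"
proof -
  have "(THE y. \<iota> y = \<iota> z) = z"
    by (rule the_equality) auto
  then show ?thesis
    using assms by (simp add: mobius_def mobius_denom_def den_def num_def A_eq)
qed

lemma iota_mobius:
  assumes "cl_unit (den x)"
  shows "\<iota> (mobius \<iota> A x) = num x * cl_inv (den x)"
proof -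
  obtain z where z: "num x * rv (den x) = \<iota> z"
    using sandwich_values by blast
  have "\<iota> (z /\<^sub>R mobius_norm \<iota> A x) = num x * cl_inv (den x)"
    by (simp add: regularI(2)[OF regularD(2,3,1)[OF assms]] iota_simps z[symmetric])
  then show ?thesis
    by (metis (no_types, lifting) mobius_eqI)
qed

end

locale vahlen_point = vahlen +
  fixes x :: 'a
  assumes regular: "cl_unit (den x)"
begin

definition r :: real where "r = mobius_norm \<iota> A x"
definition den_inv :: 'b where "den_inv = rv (den x) /\<^sub>R r"

lemma r_nonzero: "r \<noteq> 0"
  and den_norm: "den x * rv (den x) = of_real r" "rv (den x) * den x = of_real r"
  using regularD[OF regular] by (simp_all add: r_def)

lemma rv_den: "rv (den x) = r *\<^sub>R den_inv"
  using r_nonzero by (simp add: den_inv_def)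

lemma inverse_den [simp]: "den x * den_inv = 1" "den_inv * den x = 1"
  using r_nonzero den_norm by (simp_all add: den_inv_def of_real_def)

lemma inverse_den_assoc [simp]: "den x * (den_inv * z) = z" "den_inv * (den x * z) = z"
  by (simp_all add: mult.assoc[symmetric])

lemma rv_i: "rv den_inv = den x /\<^sub>R r"
  by (simp add: den_inv_def)

lemma cl_inv_den: "cl_inv (den x) = den_inv"
  by (rule cl_inv_eqI) simp_all

text \<open>
  By \<open>vector_criterion\<close>: the element is odd by homogeneity, and its anticommutator with \<open>v\<close> equals
  the derivative of the norm in direction \<open>v\<close> divided by the norm, a real number by \<open>tangent\<close>.
\<close>

lemma w_exists: "\<exists>w. den_inv * c = \<iota> w"
proof -
  obtain t where t: "t * t = 1" "gi (den x) = t *\<^sub>R den x" "gi c = - (t *\<^sub>R c)"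
    using den_homogeneous by metis
  have "gi den_inv = t *\<^sub>R den_inv"
    by (simp add: den_inv_def rv_gi[symmetric] t(2))
  then have odd: "gi (den_inv * c) = - (den_inv * c)"
    by (simp add: t(1,3))
  have cden: "den_inv * c * rv (den x) = rv c"
  proof -
    have "c * rv (den x) = den x * rv c"
      by (simp add: den_def algebra_simps adj_relations(5))
    then show ?thesis by (simp add: mult.assoc)
  qed
  have "\<exists>s. den_inv * c * \<iota> v + \<iota> v * (den_inv * c) = of_real s" for v
  proof -
    obtain l where l: "c * \<iota> v * rv (den x) + den x * \<iota> v * rv c = of_real l"
      using tangent[where h = v and x = x] by blast
    have "(den_inv * c * \<iota> v + \<iota> v * (den_inv * c)) * rv (den x) =
        den_inv * (c * \<iota> v * rv (den x) + den x * \<iota> v * rv c)"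
      unfolding cden[symmetric] by (simp add: distrib_left distrib_right mult.assoc)
    also have "\<dots> = of_real (l / r) * rv (den x)"
      by (subst l) (simp add: rv_den of_real_def r_nonzero)
    finally have "(den_inv * c * \<iota> v + \<iota> v * (den_inv * c)) * rv (den x) * rv den_inv =
        of_real (l / r) * rv (den x) * rv den_inv"
      by simp
    then show ?thesis
      by (simp add: mult.assoc rv_mult[symmetric] del: rv_mult)
  qed
  then show ?thesis
    using vector_criterion[OF odd] by metis
qed

definition w :: 'a where "w = (SOME w. den_inv * c = \<iota> w)"

lemma iota_w: "\<iota> w = den_inv * c"
  using someI_ex[OF w_exists] by (simp add: w_def)

lemma c_eq: "c = den x * \<iota> w"
  by (simp add: iota_w)

text \<open>
  Up to the factor \<open>\<delta> / r\<close>, the element is the derivative of the transformation in direction \<open>h\<close>. The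
  quotient rule expresses it by the two derivatives in \<open>tangent\<close>: with \<open>z\<close> and \<open>l\<close> as given there,
  \<open>z - l (A x)\<close> is a vector, and \<open>adj_relations\<close> turn it into \<open>\<delta> u h u\<^sup>-\<^sup>1\<close>.
\<close>

lemma E_exists: "\<exists>z. den x * \<iota> h * den_inv = \<iota> z"
proof -
  obtain z l where z: "a * \<iota> h * rv (den x) + num x * \<iota> h * rv c = \<iota> z"
    and l: "c * \<iota> h * rv (den x) + den x * \<iota> h * rv c = of_real l"
    using tangent[where h = h and x = x] by blast
  let ?m = "mobius \<iota> A x"
  have m: "\<iota> ?m = num x * den_inv"
    using iota_mobius[OF regular] by (simp add: cl_inv_den)
  have m': "\<iota> ?m = rv den_inv * rv (num x)"
    by (metis m rv_iota rv_mult)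
  have one: "rv den_inv * rv (den x) = 1"
    by (simp add: rv_mult[symmetric] del: rv_mult)
  have "\<iota> (z - l *\<^sub>R ?m) = \<iota> z - num x * den_inv * of_real l"
    by (simp add: iota_simps m of_real_def)
  also have "\<dots> = (a - num x * den_inv * c) * \<iota> h * rv (den x)"
    unfolding z[symmetric] l[symmetric] by (simp add: algebra_simps)
  also have "a - num x * den_inv * c = rv den_inv * (rv (den x) * a - rv (num x) * c)"
    unfolding m[symmetric] m' by (simp add: right_diff_distrib mult.assoc[symmetric] one)
  also have "rv (den x) * a - rv (num x) * c = of_real \<delta>"
  proof -
    have "rv (den x) * a - rv (num x) * c = \<iota> x * (rv c * a - rv a * c) + (rv d * a - rv b * c)"
      by (simp add: den_def num_def algebra_simps)
    then show ?thesis by (simp add: adj_relations)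
  qed
  also have "rv den_inv * of_real \<delta> * \<iota> h * rv (den x) = \<delta> *\<^sub>R (den x * \<iota> h * den_inv)"
    using r_nonzero by (simp add: rv_i rv_den of_real_def)
  finally have "\<iota> ((z - l *\<^sub>R ?m) /\<^sub>R \<delta>) = den x * \<iota> h * den_inv"
    by (simp add: linear_scale[OF linear_iota] delta_nonzero)
  then show ?thesis by metis
qed

definition E :: "'a \<Rightarrow> 'a" where "E h = (SOME z. den x * \<iota> h * den_inv = \<iota> z)"

lemma iota_E: "\<iota> (E h) = den x * \<iota> h * den_inv"
  using someI_ex[OF E_exists[of h]] by (simp add: E_def)

lemma linear_E: "linear E"
proof (rule linearI)
  show "E (g + h) = E g + E h" for g h
    by (subst iota_eq_iff[symmetric]) (simp only: iota_E iota_simps distrib_left distrib_right)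
  show "E (s *\<^sub>R h) = s *\<^sub>R E h" for s h
    by (subst iota_eq_iff[symmetric]) (simp add: iota_E iota_simps)
qed

lemma Q_E: "Q (E h) = Q h"
proof -
  have "- of_real (Q (E h)) = den x * (\<iota> h * \<iota> h) * den_inv"
    unfolding iota_square[symmetric] iota_E by (simp add: mult.assoc)
  also have "\<dots> = - of_real (Q h)"
    by (simp add: iota_square of_real_def)
  finally show ?thesis by simp
qed

lemma B_E: "B (E g) (E h) = B g h"
  by (simp add: polar_form_def linear_add[OF linear_E, symmetric] Q_E)

text \<open>
  The preimage is \<open>u\<^sup>-\<^sup>1 v u\<close>. It is a vector by \<open>vector_criterion\<close>, since its anticommutator
  with \<open>h\<close> is conjugate to that of \<open>v\<close> with \<open>E h\<close>.
\<close>

lemma surj_E: "\<exists>h. E h = v"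
proof -
  obtain t where t: "t * t = 1" "gi (den x) = t *\<^sub>R den x"
    using den_homogeneous by metis
  have "gi den_inv = t *\<^sub>R den_inv"
    by (simp add: den_inv_def rv_gi[symmetric] t(2))
  then have odd: "gi (den_inv * \<iota> v * den x) = - (den_inv * \<iota> v * den x)"
    by (simp add: t)
  have "\<exists>s. (den_inv * \<iota> v * den x) * \<iota> h + \<iota> h * (den_inv * \<iota> v * den x) = of_real s" for h
  proof -
    have "(den_inv * \<iota> v * den x) * \<iota> h + \<iota> h * (den_inv * \<iota> v * den x) =
        den_inv * (\<iota> v * \<iota> (E h) + \<iota> (E h) * \<iota> v) * den x"
      by (simp add: iota_E algebra_simps)
    also have "\<dots> = of_real (- (2 * B v (E h)))"
      unfolding iota_anticomm by (simp add: of_real_def)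
    finally show ?thesis by blast
  qed
  then obtain h where h: "den_inv * \<iota> v * den x = \<iota> h"
    using vector_criterion[OF odd] by blast
  have "\<iota> (E h) = \<iota> v"
    by (simp add: iota_E h[symmetric] mult.assoc)
  then show ?thesis by auto
qed

text \<open>
  The ratio of the norms at \<open>x + h\<close> and at \<open>x\<close>, see \<open>norm_displaced\<close>.
\<close>

definition \<rho> :: "'a \<Rightarrow> real" where "\<rho> h = 1 - 2 * B w h + Q w * Q h"

lemma den_displaced: "den (x + h) = den x * (1 + \<iota> w * \<iota> h)"
proof -
  have "den (x + h) = den x + c * \<iota> h"
    by (simp add: den_def iota_simps algebra_simps)
  then show ?thesis
    by (simp add: distrib_left mult.assoc[symmetric] c_eq[symmetric])
qed

lemma rho_factor:
  "(1 + \<iota> w * \<iota> h) * (1 + \<iota> h * \<iota> w) = of_real (\<rho> h)"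
  "(1 + \<iota> h * \<iota> w) * (1 + \<iota> w * \<iota> h) = of_real (\<rho> h)"
proof -
  have sq: "\<iota> v * (\<iota> v * z) = - (Q v *\<^sub>R z)" for v z
    by (simp add: mult.assoc[symmetric] iota_square scaleR_conv_of_real)
  have "(1 + \<iota> w * \<iota> h) * (1 + \<iota> h * \<iota> w) =
      1 + (\<iota> w * \<iota> h + \<iota> h * \<iota> w) + \<iota> w * (\<iota> h * (\<iota> h * \<iota> w))"
    by (simp add: algebra_simps)
  then show "(1 + \<iota> w * \<iota> h) * (1 + \<iota> h * \<iota> w) = of_real (\<rho> h)"
    by (simp only: iota_anticomm sq) (simp add: iota_square \<rho>_def of_real_def algebra_simps)
  have "(1 + \<iota> h * \<iota> w) * (1 + \<iota> w * \<iota> h) =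
      1 + (\<iota> w * \<iota> h + \<iota> h * \<iota> w) + \<iota> h * (\<iota> w * (\<iota> w * \<iota> h))"
    by (simp add: algebra_simps)
  then show "(1 + \<iota> h * \<iota> w) * (1 + \<iota> w * \<iota> h) = of_real (\<rho> h)"
    by (simp only: iota_anticomm sq) (simp add: iota_square \<rho>_def of_real_def algebra_simps)
qed

lemma norm_displaced:
  "den (x + h) * rv (den (x + h)) = of_real (r * \<rho> h)"
  "rv (den (x + h)) * den (x + h) = of_real (r * \<rho> h)"
proof -
  have rv: "rv (den (x + h)) = (1 + \<iota> h * \<iota> w) * rv (den x)"
    by (simp add: den_displaced)
  have "den (x + h) * rv (den (x + h)) = den x * ((1 + \<iota> w * \<iota> h) * (1 + \<iota> h * \<iota> w)) * rv (den x)"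
    by (simp add: rv den_displaced mult.assoc)
  then show "den (x + h) * rv (den (x + h)) = of_real (r * \<rho> h)"
    by (simp add: rho_factor den_norm) (simp add: of_real_def den_norm)
  have "rv (den (x + h)) * den (x + h) =
      (1 + \<iota> h * \<iota> w) * (rv (den x) * den x) * (1 + \<iota> w * \<iota> h)"
    by (simp add: rv den_displaced mult.assoc)
  also have "\<dots> = r *\<^sub>R ((1 + \<iota> h * \<iota> w) * (1 + \<iota> w * \<iota> h))"
    unfolding den_norm by (simp add: of_real_def)
  finally show "rv (den (x + h)) * den (x + h) = of_real (r * \<rho> h)"
    by (simp add: rho_factor scaleR_conv_of_real)
qed

text \<open>
  The displaced inverse is \<open>(1 + h w) u\<^sup>-\<^sup>1 / \<rho> h\<close> by \<open>rho_factor\<close>. Inserting it in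
  \<open>cross_difference\<close> and using \<open>h h = - Q h\<close> gives the last formula.
\<close>

lemma displaced:
  assumes "\<rho> h \<noteq> 0"
  shows "cl_unit (den (x + h))"
    and "cl_inv (den (x + h)) = ((1 + \<iota> h * \<iota> w) * den_inv) /\<^sub>R \<rho> h"
    and "mobius_norm \<iota> A (x + h) = r * \<rho> h"
    and "mobius \<iota> A (x + h) = mobius \<iota> A x + (\<delta> / (r * \<rho> h)) *\<^sub>R (E h - Q h *\<^sub>R E w)"
proof -
  have nz: "r * \<rho> h \<noteq> 0"
    using assms r_nonzero by simp
  note reg = regularI[OF norm_displaced nz]
  show u: "cl_unit (den (x + h))" and "mobius_norm \<iota> A (x + h) = r * \<rho> h"
    using reg by blast+
  show inv: "cl_inv (den (x + h)) = ((1 + \<iota> h * \<iota> w) * den_inv) /\<^sub>R \<rho> h"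
    using r_nonzero by (simp add: reg(2)) (simp add: den_displaced rv_den)
  have m: "\<iota> (mobius \<iota> A x) = num x * den_inv"
    using iota_mobius[OF regular] by (simp add: cl_inv_den)
  have m': "\<iota> (mobius \<iota> A x) = rv den_inv * rv (num x)"
    by (metis m rv_iota rv_mult)
  let ?j = "cl_inv (den (x + h))"
  have j: "den (x + h) * ?j = 1"
    using u cl_inv_eqI unfolding cl_unit_def by metis
  have one: "rv den_inv * rv (den x) = 1"
    by (simp add: rv_mult[symmetric] del: rv_mult)
  have "\<iota> (mobius \<iota> A (x + h)) - \<iota> (mobius \<iota> A x) =
      rv den_inv * (rv (den x) * num (x + h) - rv (num x) * den (x + h)) * ?j"
    unfolding iota_mobius[OF u] m'
    by (simp add: left_diff_distrib right_diff_distrib mult.assoc j)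
      (simp add: mult.assoc[symmetric] one)
  also have "\<dots> = rv den_inv * (of_real \<delta> * \<iota> h) * ?j"
    by (simp add: cross_difference)
  also have "\<dots> = (\<delta> / (r * \<rho> h)) *\<^sub>R (den x * \<iota> h * ((1 + \<iota> h * \<iota> w) * den_inv))"
    by (simp add: inv rv_i of_real_def divide_inverse mult_ac)
  also have "den x * \<iota> h * ((1 + \<iota> h * \<iota> w) * den_inv) = \<iota> (E h - Q h *\<^sub>R E w)"
  proof -
    have "den x * \<iota> h * ((1 + \<iota> h * \<iota> w) * den_inv) = den x * \<iota> h * den_inv + den x * ((\<iota> h * \<iota> h) * \<iota> w) * den_inv"
      by (simp add: algebra_simps)
    then show ?thesis
      by (simp add: iota_square iota_simps iota_E) (simp add: of_real_def)
  qed
  finally have "\<iota> (mobius \<iota> A (x + h)) =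
      \<iota> (mobius \<iota> A x + (\<delta> / (r * \<rho> h)) *\<^sub>R (E h - Q h *\<^sub>R E w))"
    by (simp only: iota_simps) (simp add: algebra_simps)
  then show "mobius \<iota> A (x + h) = mobius \<iota> A x + (\<delta> / (r * \<rho> h)) *\<^sub>R (E h - Q h *\<^sub>R E w)"
    by (simp only: iota_eq_iff)
qed

end


section \<open>Transformation of the Dirac operator\<close>

text \<open>
  Independence of the Dirac operator of the choice of the orthogonal basis. The first argument
  is expanded in the basis \<open>e\<close>; the coefficients \<open>B (E e\<^sub>j) e\<^sub>k = B e\<^sub>j (E\<^sup>-\<^sup>1 e\<^sub>k)\<close> then
  reassemble the second argument to \<open>E (E\<^sup>-\<^sup>1 e\<^sub>k)\<close>.
\<close>

lemma (in clifford_frame) sum_basis_isometry: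
  assumes "linear E" and B_E: "\<And>g h. B (E g) (E h) = B g h" and surj: "\<And>v. \<exists>h. E h = v"
    and lin1: "\<And>v. linear (\<lambda>u. \<beta> u v)" and lin2: "\<And>u. linear (\<beta> u)"
  shows "(\<Sum>j\<in>I. Q (e j) *\<^sub>R \<beta> (E (e j)) (E (e j))) = (\<Sum>j\<in>I. Q (e j) *\<^sub>R \<beta> (e j) (e j))"
proof -
  obtain F where F: "\<And>v. E (F v) = v"
    using surj by metis
  have coeff: "B (E (e j)) (e k) = B (F (e k)) (e j)" for j k
    by (metis B_E F B_commute)
  have "(\<Sum>j\<in>I. Q (e j) *\<^sub>R \<beta> (E (e j)) (E (e j))) =
      (\<Sum>j\<in>I. \<Sum>k\<in>I. (Q (e j) * Q (e k) * B (F (e k)) (e j)) *\<^sub>R \<beta> (e k) (E (e j)))"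
  proof (rule sum.cong)
    fix j assume "j \<in> I"
    have "\<beta> (E (e j)) (E (e j)) = (\<Sum>k\<in>I. (Q (e k) * B (F (e k)) (e j)) *\<^sub>R \<beta> (e k) (E (e j)))"
      by (subst (1) basis_expansion[of "E (e j)"])
        (simp add: linear_sum[OF lin1] linear_scale[OF lin1] coeff)
    then show "Q (e j) *\<^sub>R \<beta> (E (e j)) (E (e j)) =
        (\<Sum>k\<in>I. (Q (e j) * Q (e k) * B (F (e k)) (e j)) *\<^sub>R \<beta> (e k) (E (e j)))"
      by (simp add: scaleR_right.sum mult.assoc)
  qed simp
  also have "\<dots> = (\<Sum>k\<in>I. \<Sum>j\<in>I. (Q (e j) * Q (e k) * B (F (e k)) (e j)) *\<^sub>R \<beta> (e k) (E (e j)))"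
    by (rule sum.swap)
  also have "\<dots> = (\<Sum>k\<in>I. Q (e k) *\<^sub>R \<beta> (e k) (e k))"
  proof (rule sum.cong)
    fix k assume "k \<in> I"
    have "(\<Sum>j\<in>I. (Q (e j) * Q (e k) * B (F (e k)) (e j)) *\<^sub>R \<beta> (e k) (E (e j))) =
        Q (e k) *\<^sub>R \<beta> (e k) (E (\<Sum>j\<in>I. (Q (e j) * B (F (e k)) (e j)) *\<^sub>R e j))"
      by (simp add: linear_sum[OF lin2] linear_scale[OF lin2] linear_sum[OF assms(1)]
          linear_scale[OF assms(1)] scaleR_right.sum mult_ac)
    then show "(\<Sum>j\<in>I. (Q (e j) * Q (e k) * B (F (e k)) (e j)) *\<^sub>R \<beta> (e k) (E (e j))) =
        Q (e k) *\<^sub>R \<beta> (e k) (e k)"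
      by (simp only: basis_expansion[symmetric] F)
  qed simp
  finally show ?thesis .
qed

lemma isCont_tendsto_nhds: "isCont g a \<Longrightarrow> (g \<longlongrightarrow> g a) (nhds a)"
  unfolding isCont_def by (rule tendsto_at_iff_tendsto_nhds[THEN iffD1])

lemma partial_deriv_eq:
  assumes "(f has_derivative f') (at y)"
  shows "partial_deriv v f y = f' v"
proof -
  have "((\<lambda>t. y + t *\<^sub>R v) has_derivative (\<lambda>t. t *\<^sub>R v)) (at 0)"
    by (auto intro!: derivative_eq_intros)
  then have "((\<lambda>t. f (y + t *\<^sub>R v)) has_derivative (\<lambda>t. f' (t *\<^sub>R v))) (at 0)"
    by (rule has_derivative_compose) (use assms in simp)
  then have "((\<lambda>t. f (y + t *\<^sub>R v)) has_vector_derivative f' v) (at 0)"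
    using linear_scale[OF has_derivative_linear[OF assms]] by (simp add: has_vector_derivative_def)
  then show ?thesis
    unfolding partial_deriv_def by (rule vector_derivative_at)
qed

locale vahlen_module =
  vahlen Q \<iota> p q e A a b c d
  for Q :: "'v::real_normed_vector \<Rightarrow> real" and \<iota> :: "'v \<Rightarrow> 'c::real_algebra_1"
    and p q e A a b c d +
  fixes act :: "'c \<Rightarrow> 'm::real_normed_vector \<Rightarrow> 'm"
  assumes module: "left_cl_module act"
begin

lemmas finite_dim = finite_I basis_inj basis_independent basis_span

lemma act_mult: "act (y * z) m = act y (act z m)" and bounded_linear_act: "bounded_linear (act z)"
  and act_add: "act (y + z) m = act y m + act z m" and act_scale: "act (s *\<^sub>R z) m = s *\<^sub>R act z m"
  and act_one: "act 1 m = m"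
  using module by (auto simp: left_cl_module_def)

lemma linear_act: "linear (act z)" "linear (\<lambda>z. act z m)"
  using bounded_linear.linear[OF bounded_linear_act] by (auto intro!: linearI simp: act_add act_scale)

lemmas act_simps =
  linear_add[OF linear_act(1)] linear_diff[OF linear_act(1)] linear_neg[OF linear_act(1)]
  linear_scale[OF linear_act(1)] linear_0[OF linear_act(1)] linear_sum[OF linear_act(1)]
  linear_add[OF linear_act(2)] linear_diff[OF linear_act(2)] linear_neg[OF linear_act(2)]
  linear_scale[OF linear_act(2)] linear_0[OF linear_act(2)] linear_sum[OF linear_act(2)]

lemma dirac_left_eq:
  assumes "(f has_derivative f') (at y)"
  shows "dirac_left \<iota> act p q e f y = (\<Sum>j\<in>I. Q (e j) *\<^sub>R act (\<iota> (e j)) (f' (e j)))"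
proof -
  let ?g = "\<lambda>j. Q (e j) *\<^sub>R act (\<iota> (e j)) (f' (e j))"
  have "I = {1..p} \<union> {p+1..p+q}" "{1..p} \<inter> {p+1..p+q} = {}"
    by (auto simp: I_def)
  then have "sum ?g I = sum ?g {1..p} + sum ?g {p+1..p+q}"
    by (simp add: sum.union_disjoint)
  also have "sum ?g {1..p} = (\<Sum>j=1..p. act (\<iota> (e j)) (f' (e j)))"
    by (rule sum.cong) (auto simp: basis_Q I_def)
  also have "sum ?g {p+1..p+q} = - (\<Sum>j=p+1..p+q. act (\<iota> (e j)) (f' (e j)))"
    unfolding sum_negf[symmetric] by (rule sum.cong) (auto simp: basis_Q I_def)
  finally show ?thesis
    by (simp add: dirac_left_def partial_deriv_eq[OF assms])
qed

definition pullback :: "('v \<Rightarrow> 'm) \<Rightarrow> 'v \<Rightarrow> 'm" where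
  "pullback f y = act (J_factor \<iota> A y) (f (mobius \<iota> A y))"

end

locale vahlen_module_point = vahlen_module + vahlen_point
begin

lemma bounded_linear_E: "bounded_linear E"
  by (rule finite_dim_linear_bounded[OF finite_dim linear_E])

lemma bounded_linear_B: "bounded_linear (B v)"
  by (rule finite_dim_linear_bounded[OF finite_dim linear_B(1)])

lemma bounded_bilinear_B: "bounded_bilinear B"
  by (rule finite_dim_bilinear_bounded[OF finite_dim linear_B(2) bounded_linear_B])

lemma bounded_bilinear_iota_act: "bounded_bilinear (\<lambda>h. act (\<iota> h))"
proof (rule finite_dim_bilinear_bounded[OF finite_dim])
  show "linear (\<lambda>h. act (\<iota> h) m)" for m
    using linear_compose[OF linear_iota linear_act(2)] by (simp add: o_def)
qed (rule bounded_linear_act)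

definition J where "J = J_factor \<iota> A x"

lemma J_eq: "J = den_inv /\<^sub>R (\<bar>r\<bar> powr (real (p + q) / 2 - 1))"
  by (simp add: J_def J_factor_def mobius_denom_eq cl_inv_den r_def dim_V)

text \<open>
  For small \<open>h\<close> the ratio \<open>\<rho> h\<close> is near 1, so the absolute value in the weight can be dropped. The
  exponent \<open>- n / 2\<close> collects \<open>- (n / 2 - 1)\<close> from the weight and \<open>-1\<close> from the inverse denominator.
\<close>

lemma J_displaced:
  assumes "\<rho> h > 0"
  shows "J_factor \<iota> A (x + h) = \<rho> h powr (- (real (p + q) / 2)) *\<^sub>R ((1 + \<iota> h * \<iota> w) * J)"
proof -
  let ?k = "real (p + q) / 2 - 1"
  have "\<rho> h powr (- (real (p + q) / 2)) = inverse (\<rho> h powr ?k * \<rho> h powr 1)"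
    by (simp only: powr_add[symmetric] powr_minus[symmetric]) simp
  also have "\<dots> = inverse (\<rho> h powr ?k) * inverse (\<rho> h)"
    using assms by (simp del: powr_mult)
  finally have pw: "\<rho> h powr (- (real (p + q) / 2)) = inverse (\<rho> h powr ?k) * inverse (\<rho> h)" .
  have "\<bar>r * \<rho> h\<bar> powr ?k = \<bar>r\<bar> powr ?k * \<rho> h powr ?k"
    using assms by (simp add: abs_mult powr_mult)
  then show ?thesis
    using displaced[of h] assms unfolding pw
    by (simp add: J_factor_def mobius_denom_eq dim_V J_eq mult_ac)
qed

text \<open>
  The displacement of the image point, \<open>A (x + h) - A x\<close>, whenever \<open>\<rho> h \<noteq> 0\<close>.
\<close>

definition shift where
  "shift h = (\<delta> / (r * \<rho> h)) *\<^sub>R (E h - Q h *\<^sub>R E w)"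

lemma rho_zero: "\<rho> 0 = 1"
  using B_simps(5)[of 0] by (simp add: \<rho>_def B_simps)

text \<open>
  A quadratic form has vanishing derivative at the origin; it is differentiable there because the
  bilinear form is bounded.
\<close>

lemma has_derivative_Q: "(Q has_derivative (\<lambda>h. 0)) (at 0)"
proof -
  have "((\<lambda>h. B h h) has_derivative (\<lambda>h. B 0 h + B h 0)) (at 0)"
    by (rule bounded_bilinear.FDERIV[OF bounded_bilinear_B]) (rule has_derivative_ident)+
  then show ?thesis by (simp add: B_simps)
qed

lemma has_derivative_rho: "(\<rho> has_derivative (\<lambda>h. - 2 * B w h)) (at 0)"
proof -
  have "((\<lambda>h. 1 - 2 * B w h + Q w * Q h) has_derivative (\<lambda>h. 0 - 2 * B w h + Q w * 0)) (at 0)"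
    by (intro has_derivative_add has_derivative_diff has_derivative_const has_derivative_Q
        has_derivative_mult_right bounded_linear_imp_has_derivative bounded_linear_B)
  then show ?thesis by (simp add: \<rho>_def[abs_def])
qed

lemma has_derivative_rho_powr:
  "((\<lambda>h. \<rho> h powr s) has_derivative (\<lambda>h. s * (- 2 * B w h))) (at 0)"
proof -
  have "((\<lambda>z. z powr s) has_real_derivative s * \<rho> 0 powr (s - 1)) (at (\<rho> 0))"
    by (rule has_real_derivative_powr) (simp add: rho_zero)
  from DERIV_compose_FDERIV[OF this has_derivative_rho] show ?thesis
    by (simp add: rho_zero mult_ac)
qed

lemma has_derivative_shift: "(shift has_derivative (\<lambda>h. (\<delta> / r) *\<^sub>R E h)) (at 0)"
proof -
  have 1: "((\<lambda>h. \<delta> / (r * \<rho> h)) has_derivative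
      (\<lambda>h. - \<delta> * (inverse (r * \<rho> 0) * (r * (- 2 * B w h)) * inverse (r * \<rho> 0)) + 0 / (r * \<rho> 0))) (at 0)"
    by (rule has_derivative_divide[OF has_derivative_const
        has_derivative_mult_right[OF has_derivative_rho]]) (simp add: rho_zero r_nonzero)
  have 2: "((\<lambda>h. E h - Q h *\<^sub>R E w) has_derivative (\<lambda>h. E h - 0 *\<^sub>R E w)) (at 0)"
    by (intro has_derivative_diff bounded_linear_imp_has_derivative bounded_linear_E
        has_derivative_scaleR_left has_derivative_Q)
  have Q0: "Q 0 = 0" using Q_scale[of 0 0] by simp
  show ?thesis
    using has_derivative_scaleR[OF 1 2]
    by (simp add: shift_def[abs_def] rho_zero Q0 linear_0[OF linear_E])
qed

lemma shift_zero: "shift 0 = 0"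
  using Q_scale[of 0 0] by (simp add: shift_def linear_0[OF linear_E])

lemma eventually_displaced: "\<forall>\<^sub>F y in nhds x. \<rho> (y - x) > 0"
proof -
  have "((\<lambda>y. \<rho> (y - x)) \<longlongrightarrow> \<rho> 0) (nhds x)"
  proof -
    have "isCont \<rho> (x - x)"
      using has_derivative_continuous[OF has_derivative_rho] by simp
    then have "isCont (\<lambda>y. \<rho> (y - x)) x"
      by (rule isCont_o2[rotated]) (rule continuous_intros)+
    from isCont_tendsto_nhds[OF this] show ?thesis by simp
  qed
  then show ?thesis
    by (rule order_tendstoD(1)) (simp add: rho_zero)
qed

lemma mobius_tendsto: "(mobius \<iota> A \<longlongrightarrow> mobius \<iota> A x) (nhds x)"
proof -
  have "isCont shift (x - x)"
    using has_derivative_continuous[OF has_derivative_shift] by simp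
  then have "isCont (\<lambda>y. mobius \<iota> A x + shift (y - x)) x"
    by (intro isCont_add continuous_const, rule isCont_o2[rotated]) (rule continuous_intros)+
  then have "((\<lambda>y. mobius \<iota> A x + shift (y - x)) \<longlongrightarrow> mobius \<iota> A x) (nhds x)"
    using isCont_tendsto_nhds by (force simp: shift_zero)
  then show ?thesis
  proof (rule Lim_transform_eventually)
    show "\<forall>\<^sub>F y in nhds x. mobius \<iota> A x + shift (y - x) = mobius \<iota> A y"
      using eventually_displaced
    proof eventually_elim
      case (elim y)
      then show ?case
        using displaced(4)[of "y - x"] by (simp add: shift_def)
    qed
  qed
qed

lemma eventually_regular: "\<forall>\<^sub>F y in nhds x. cl_unit (den y)"
  using eventually_displaced
proof eventually_elim
  case (elim y)
  then show ?case
    using displaced(1)[of "y - x"] by simp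
qed

text \<open>
  In the coordinate \<open>h = y - x\<close> the function is the product of a power of \<open>\<rho>\<close>, the affine factor
  \<open>1 + h w\<close> and \<open>f\<close> at the displaced image point. The Clifford algebra itself carries no topology;
  only its action on the module is differentiated.
\<close>

lemma pullback_has_derivative:
  assumes f: "(f has_derivative f') (at (mobius \<iota> A x))"
  shows "(pullback f has_derivative (\<lambda>h.
      (real (p + q) * B w h) *\<^sub>R act J (f (mobius \<iota> A x))
      + act (\<iota> h) (act (\<iota> w * J) (f (mobius \<iota> A x)))
      + act J (f' ((\<delta> / r) *\<^sub>R E h)))) (at x)"
    (is "(_ has_derivative ?D) _")
proof -
  let ?s = "- (real (p + q) / 2)"
  define m where "m h = f (mobius \<iota> A x + shift h)" for h
  define G where "G h = \<rho> h powr ?s *\<^sub>R (act J (m h) + act (\<iota> h) (act (\<iota> w * J) (m h)))" for h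
  have m: "(m has_derivative (\<lambda>h. f' ((\<delta> / r) *\<^sub>R E h))) (at 0)"
  proof -
    have "((\<lambda>h. mobius \<iota> A x + shift h) has_derivative (\<lambda>h. 0 + (\<delta> / r) *\<^sub>R E h)) (at 0)"
      by (intro has_derivative_add has_derivative_const has_derivative_shift)
    from has_derivative_compose[OF this, of f f'] show ?thesis
      using f by (simp add: m_def[abs_def] shift_zero)
  qed
  have m0: "m 0 = f (mobius \<iota> A x)"
    by (simp add: m_def shift_zero)
  have 1: "((\<lambda>h. act z (m h)) has_derivative (\<lambda>h. act z (f' ((\<delta> / r) *\<^sub>R E h)))) (at 0)" for z
    using bounded_linear.has_derivative[OF bounded_linear_act m] .
  have 2: "((\<lambda>h. act (\<iota> h) (act (\<iota> w * J) (m h))) has_derivative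
      (\<lambda>h. act (\<iota> 0) (act (\<iota> w * J) (f' ((\<delta> / r) *\<^sub>R E h))) + act (\<iota> h) (act (\<iota> w * J) (m 0)))) (at 0)"
    by (rule bounded_bilinear.FDERIV[OF bounded_bilinear_iota_act has_derivative_ident 1])
  have "(G has_derivative ?D) (at 0)"
    unfolding G_def[abs_def]
    using has_derivative_scaleR[OF has_derivative_rho_powr[of ?s] has_derivative_add[OF 1[of J] 2]]
    by (simp add: rho_zero m0 iota_simps act_simps add_ac)
  then have "(G has_derivative ?D) (at (x - x))" by simp
  moreover have "((\<lambda>y. y - x) has_derivative (\<lambda>h. h)) (at x)"
    by (auto intro!: derivative_eq_intros)
  ultimately have "((\<lambda>y. G (y - x)) has_derivative ?D) (at x)"
    using has_derivative_compose[of "\<lambda>y. y - x" "\<lambda>h. h" x UNIV G ?D] by simp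
  moreover have ev: "\<forall>\<^sub>F y in nhds x. G (y - x) = pullback f y"
    using eventually_displaced
  proof eventually_elim
    case (elim y)
    then show ?case
      using J_displaced[of "y - x"] displaced(4)[of "y - x"]
      by (simp add: G_def pullback_def m_def shift_def act_simps distrib_right act_mult mult.assoc)
  qed
  ultimately show ?thesis
    using has_derivative_transform_eventually[of "\<lambda>y. G (y - x)" ?D x UNIV "pullback f"]
      eventually_nhds_x_imp_x[OF ev] eventually_mono[OF ev] by (auto simp: eventually_at_filter)
qed

text \<open>
  The three sums are the contributions of the weight, of the affine factor \<open>1 + h w\<close> and of the
  argument of \<open>f\<close>. The exponent in the weight is exactly the one for which the first two cancel.
\<close>

lemma dirac_pullback:
  assumes f: "f differentiable (at (mobius \<iota> A x))"
  shows "pullback f differentiable (at x)"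
    and "dirac_left \<iota> act p q e (pullback f) x =
      Omega_factor \<iota> A x *\<^sub>R act J (dirac_left \<iota> act p q e f (mobius \<iota> A x))"
proof -
  obtain f' where f': "(f has_derivative f') (at (mobius \<iota> A x))"
    using f by (auto simp: differentiable_def)
  note D = pullback_has_derivative[OF f']
  show "pullback f differentiable (at x)"
    using D by (auto simp: differentiable_def)
  have lin': "linear f'"
    by (rule has_derivative_linear[OF f'])
  let ?m = "f (mobius \<iota> A x)"
  \<comment> \<open>Moving the weight past a vector rotates the vector by \<open>E\<close>.\<close>
  have rot: "\<iota> h * J = J * \<iota> (E h)" for h
    by (simp add: J_eq iota_E mult.assoc)
  have 1: "(\<Sum>j\<in>I. Q (e j) *\<^sub>R act (\<iota> (e j)) ((real (p + q) * B w (e j)) *\<^sub>R act J ?m)) =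
      real (p + q) *\<^sub>R act (\<iota> w * J) ?m"
  proof -
    have "\<iota> w = (\<Sum>j\<in>I. (Q (e j) * B w (e j)) *\<^sub>R \<iota> (e j))"
      by (subst basis_expansion[of w]) (simp add: iota_simps)
    then have "act (\<iota> w * J) ?m = (\<Sum>j\<in>I. (Q (e j) * B w (e j)) *\<^sub>R act (\<iota> (e j)) (act J ?m))"
      by (simp add: act_mult act_simps)
    then show ?thesis
      by (simp add: act_simps scaleR_right.sum mult_ac)
  qed
  have 2: "(\<Sum>j\<in>I. Q (e j) *\<^sub>R act (\<iota> (e j)) (act (\<iota> (e j)) (act (\<iota> w * J) ?m))) =
      - (real (p + q) *\<^sub>R act (\<iota> w * J) ?m)"
  proof -
    have "Q (e j) *\<^sub>R act (\<iota> (e j)) (act (\<iota> (e j)) z) = - z" if "j \<in> I" for j z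
    proof -
      have "Q (e j) *\<^sub>R act (\<iota> (e j)) (act (\<iota> (e j)) z) = - ((Q (e j) * Q (e j)) *\<^sub>R z)"
        by (simp add: act_mult[symmetric] iota_square of_real_def act_simps act_one)
      then show ?thesis
        by (simp add: basis_Q_square[OF that])
    qed
    then show ?thesis
      by (simp add: sum_negf sum_constant_scaleR)
  qed
  have 3: "(\<Sum>j\<in>I. Q (e j) *\<^sub>R act (\<iota> (e j)) (act J (f' ((\<delta> / r) *\<^sub>R E (e j))))) =
      (\<delta> / r) *\<^sub>R act J (\<Sum>j\<in>I. Q (e j) *\<^sub>R act (\<iota> (E (e j))) (f' (E (e j))))"
    by (simp add: act_mult[symmetric] rot)
      (simp add: act_mult act_simps linear_scale[OF lin'] scaleR_right.sum mult_ac)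
  have 4: "(\<Sum>j\<in>I. Q (e j) *\<^sub>R act (\<iota> (E (e j))) (f' (E (e j)))) =
      (\<Sum>j\<in>I. Q (e j) *\<^sub>R act (\<iota> (e j)) (f' (e j)))"
  proof (rule sum_basis_isometry[where \<beta> = "\<lambda>u v. act (\<iota> u) (f' v)", OF linear_E B_E surj_E])
    show "linear (\<lambda>u. act (\<iota> u) (f' v))" for v
      using linear_compose[OF linear_iota linear_act(2)] by (simp add: o_def)
    show "linear (\<lambda>v. act (\<iota> u) (f' v))" for u
      using linear_compose[OF lin' linear_act(1)] by (simp add: o_def)
  qed
  have Omega: "Omega_factor \<iota> A x = \<delta> / r"
    by (simp add: Omega_factor_def \<delta>_def r_def)
  show "dirac_left \<iota> act p q e (pullback f) x =
      Omega_factor \<iota> A x *\<^sub>R act J (dirac_left \<iota> act p q e f (mobius \<iota> A x))"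
    unfolding dirac_left_eq[OF D] dirac_left_eq[OF f'] Omega 4[symmetric] 3[symmetric]
    by (simp only: linear_add[OF linear_act(1)] scaleR_add_right sum.distrib 1 2) simp
qed

end

context vahlen_module
begin

lemma mobius_preimage_eq: "mobius_preimage \<iota> A U = {x. cl_unit (den x) \<and> mobius \<iota> A x \<in> U}"
  by (simp add: mobius_preimage_def mobius_denom_eq)

lemma open_mobius_preimage:
  assumes "open U" shows "open (mobius_preimage \<iota> A U)"
proof (rule topological_space_class.openI)
  fix x assume "x \<in> mobius_preimage \<iota> A U"
  then have x: "cl_unit (den x)" "mobius \<iota> A x \<in> U"
    by (auto simp: mobius_preimage_eq)
  interpret vahlen_module_point Q \<iota> p q e A a b c d act x
    by unfold_locales (rule x)
  have "\<forall>\<^sub>F y in nhds x. mobius \<iota> A y \<in> U"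
    using topological_tendstoD[OF mobius_tendsto assms x(2)] .
  with eventually_regular have "\<forall>\<^sub>F y in nhds x. y \<in> mobius_preimage \<iota> A U"
    by eventually_elim (simp add: mobius_preimage_eq)
  then show "\<exists>T. open T \<and> x \<in> T \<and> T \<subseteq> mobius_preimage \<iota> A U"
    unfolding eventually_nhds by blast
qed

theorem dirac_left_covariance:
  assumes U: "open U" and f: "f differentiable_on U"
  shows "(\<forall>x\<in>mobius_preimage \<iota> A U.
          (\<lambda>y. act (J_factor \<iota> A y) (f (mobius \<iota> A y))) differentiable (at x) \<and>
          dirac_left \<iota> act p q e (\<lambda>y. act (J_factor \<iota> A y) (f (mobius \<iota> A y))) x =
            Omega_factor \<iota> A x *\<^sub>R
              act (J_factor \<iota> A x) (dirac_left \<iota> act p q e f (mobius \<iota> A x)))"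
    (is ?dirac)
    and "left_monogenic \<iota> act p q e U f \<longrightarrow>
          left_monogenic \<iota> act p q e (mobius_preimage \<iota> A U)
            (\<lambda>y. act (J_factor \<iota> A y) (f (mobius \<iota> A y)))"
proof -
  show dirac: ?dirac
  proof
    fix x assume "x \<in> mobius_preimage \<iota> A U"
    then have x: "cl_unit (den x)" "mobius \<iota> A x \<in> U"
      by (auto simp: mobius_preimage_eq)
    interpret vahlen_module_point Q \<iota> p q e A a b c d act x
      by unfold_locales (rule x)
    have "f differentiable (at (mobius \<iota> A x))"
      using f U x(2) by (simp add: differentiable_on_eq_differentiable_at)
    from dirac_pullback[OF this]
    show "(\<lambda>y. act (J_factor \<iota> A y) (f (mobius \<iota> A y))) differentiable (at x) \<and>
          dirac_left \<iota> act p q e (\<lambda>y. act (J_factor \<iota> A y) (f (mobius \<iota> A y))) x =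
            Omega_factor \<iota> A x *\<^sub>R
              act (J_factor \<iota> A x) (dirac_left \<iota> act p q e f (mobius \<iota> A x))"
      by (simp add: pullback_def[abs_def] J_def)
  qed
  show "left_monogenic \<iota> act p q e U f \<longrightarrow>
          left_monogenic \<iota> act p q e (mobius_preimage \<iota> A U)
            (\<lambda>y. act (J_factor \<iota> A y) (f (mobius \<iota> A y)))"
    using dirac open_mobius_preimage[OF U] linear_0[OF linear_act(1)]
    by (auto simp: left_monogenic_def differentiable_on_eq_differentiable_at mobius_preimage_eq)
qed

end

lemma (in vahlen) reversal_J_factor:
  assumes "cl_unit (den x)" shows "rv (J_factor \<iota> A x) = J_factor_rev \<iota> A x"
  using regularI(2,3)[OF regularD(2,3,1)[OF assms]]
  by (simp add: J_factor_def J_factor_rev_def mobius_denom_eq)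

theorem theorem36:
  fixes Q :: "'v::real_normed_vector \<Rightarrow> real"
    and \<iota> :: "'v \<Rightarrow> 'c::real_algebra_1"
    and e :: "nat \<Rightarrow> 'v"
    and p q :: nat
    and U :: "'v set"
    and A :: "'c^2^2"
    and lact :: "'c \<Rightarrow> 'm::real_normed_vector \<Rightarrow> 'm"
    and ract :: "'k::real_normed_vector \<Rightarrow> 'c \<Rightarrow> 'k"
    and f :: "'v \<Rightarrow> 'm"
    and g :: "'v \<Rightarrow> 'k"
  assumes "quadratic_form Q" and "nondegenerate Q"
    and "universal_clifford Q \<iota>"
    and "orthogonal_basis Q p q e"
    and "open U"
    and "vahlen_matrix \<iota> A"
  shows
    "(left_cl_module lact \<and> f differentiable_on U \<longrightarrow>
       (\<forall>x\<in>mobius_preimage \<iota> A U.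
          (\<lambda>y. lact (J_factor \<iota> A y) (f (mobius \<iota> A y))) differentiable (at x) \<and>
          dirac_left \<iota> lact p q e (\<lambda>y. lact (J_factor \<iota> A y) (f (mobius \<iota> A y))) x =
            Omega_factor \<iota> A x *\<^sub>R
              lact (J_factor \<iota> A x) (dirac_left \<iota> lact p q e f (mobius \<iota> A x))) \<and>
       (left_monogenic \<iota> lact p q e U f \<longrightarrow>
          left_monogenic \<iota> lact p q e (mobius_preimage \<iota> A U)
            (\<lambda>y. lact (J_factor \<iota> A y) (f (mobius \<iota> A y))))) \<and>
     (right_cl_module ract \<and> g differentiable_on U \<longrightarrow>
       (\<forall>x\<in>mobius_preimage \<iota> A U.
          (\<lambda>y. ract (g (mobius \<iota> A y)) (J_factor_rev \<iota> A y)) differentiable (at x) \<and>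
          dirac_right \<iota> ract p q e (\<lambda>y. ract (g (mobius \<iota> A y)) (J_factor_rev \<iota> A y)) x =
            Omega_factor \<iota> A x *\<^sub>R
              ract (dirac_right \<iota> ract p q e g (mobius \<iota> A x)) (J_factor_rev \<iota> A x)) \<and>
       (right_monogenic \<iota> ract p q e U g \<longrightarrow>
          right_monogenic \<iota> ract p q e (mobius_preimage \<iota> A U)
            (\<lambda>y. ract (g (mobius \<iota> A y)) (J_factor_rev \<iota> A y))))"
    (is "(?left \<longrightarrow> ?L) \<and> (?right \<longrightarrow> ?R)")
proof (intro conjI[of "?left \<longrightarrow> ?L"] impI)
  interpret vahlen Q \<iota> p q e A "A$1$1" "A$1$2" "A$2$1" "A$2$2"
    using assms by unfold_locales (simp_all add: mat22_eta)
  show ?L if left: ?left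
  proof -
    interpret L: vahlen_module Q \<iota> p q e A "A$1$1" "A$1$2" "A$2$1" "A$2$2" lact
      using left by unfold_locales simp
    show ?thesis
      using L.dirac_left_covariance \<open>open U\<close> left by blast
  qed
  show ?R if right: ?right
  proof -
    \<comment> \<open>The reversal turns the right module into a left module, and it fixes the basis vectors.\<close>
    let ?act = "\<lambda>z m. ract m (rv z)"
    have "left_cl_module ?act"
      using right by (simp add: left_cl_module_def right_cl_module_def)
    then interpret R: vahlen_module Q \<iota> p q e A "A$1$1" "A$1$2" "A$2$1" "A$2$2" ?act
      by unfold_locales
    have dirac: "dirac_left \<iota> ?act p q e = dirac_right \<iota> ract p q e"
      by (simp add: fun_eq_iff dirac_left_def dirac_right_def)
    have regular: "cl_unit (den x)" if "x \<in> mobius_preimage \<iota> A U" for x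
      using that by (simp add: R.mobius_preimage_eq)
    define F where "F y = ract (g (mobius \<iota> A y)) (rv (J_factor \<iota> A y))" for y
    define G where "G y = ract (g (mobius \<iota> A y)) (J_factor_rev \<iota> A y)" for y
    have opn: "open (mobius_preimage \<iota> A U)"
      by (rule R.open_mobius_preimage[OF \<open>open U\<close>])
    have FG: "F y = G y" if "y \<in> mobius_preimage \<iota> A U" for y
      using reversal_J_factor[OF regular[OF that]] by (simp add: F_def G_def)
    \<comment> \<open>\<open>F\<close> and \<open>G\<close> agree only on the open set of regular points, which suffices for derivatives.\<close>
    have main: "G differentiable (at x) \<and> dirac_right \<iota> ract p q e G x =
        Omega_factor \<iota> A x *\<^sub>R ract (dirac_right \<iota> ract p q e g (mobius \<iota> A x)) (J_factor_rev \<iota> A x)"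
      if x: "x \<in> mobius_preimage \<iota> A U" for x
    proof -
      have F: "F differentiable (at x)" "dirac_right \<iota> ract p q e F x =
          Omega_factor \<iota> A x *\<^sub>R ract (dirac_right \<iota> ract p q e g (mobius \<iota> A x)) (J_factor_rev \<iota> A x)"
        using R.dirac_left_covariance(1)[OF \<open>open U\<close>, of g] right x
          reversal_J_factor[OF regular[OF x]]
        unfolding dirac F_def[abs_def] by auto
      obtain F' where F': "(F has_derivative F') (at x)"
        using F(1) by (auto simp: differentiable_def)
      then have G': "(G has_derivative F') (at x)"
        by (rule has_derivative_transform_within_open[OF _ opn x FG])
      have "dirac_right \<iota> ract p q e G x = dirac_right \<iota> ract p q e F x"
        by (simp only: dirac[symmetric] R.dirac_left_eq[OF F'] R.dirac_left_eq[OF G'])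
      then show ?thesis
        using F(2) G' by (auto simp: differentiable_def)
    qed
    have zero: "ract 0 z = 0" for z
      using linear_0[OF R.linear_act(1), of "rv z"] by simp
    have "right_monogenic \<iota> ract p q e (mobius_preimage \<iota> A U) G"
      if "right_monogenic \<iota> ract p q e U g"
      using that main opn zero
      by (auto simp: right_monogenic_def differentiable_on_eq_differentiable_at R.mobius_preimage_eq)
    then show ?thesis
      using main unfolding G_def[abs_def] by blast
  qed
qed

end
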